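(* Let the assumptions (A1)–(A3) of the context hold. Let $u^*\in\mathbb U$, with corresponding processes $(X^*,Y^*,Z^* )$ and adjoint processes $(p,q,k)$ as in the context. Define the Hamiltonian $$H(n,x,y,z,u,p,q,k)=b(n,x,u)p+\sigma(n,x,u)p\,\mathbb E[\xi^H_n\mid\mathcal F_n]+\beta(n,n)\sigma(n,x,u)q-f(n,x,y,z,u)k .$$ Assume that $H(n,x,y,z,u,p,q,k)$ is convex with respect to $(x,y,z,u)$ (i.e. for every $n\in\mathcal T$, almost surely, $(x,y,z,u)\mapsto H(n,x,y,z,u,p_n,q_n,k_n)$ is convex), and that for all $u\in\mathbb U$ and $n\in\mathcal T$, almost surely, $$\Big[b_u^*(n)p_n+\sigma_u^*(n)p_n\sum_{k=0}^{n-1}\gamma(n,k)\xi^H_k+\beta(n,n)\sigma_u^*(n)q_n-f_u^*(n)k_n\Big]\cdot(u_n-u^*_n)\ge0 .$$ Then $u^*$ is an optimal control, i.e. $J(u^* )=\inf_{u\in\mathbb U}J(u)$.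
   Context: **Noise.** $\mathcal T=\{0,1,2,\dots\}$. $H\in(0,1)$ (Hurst parameter, not the Hamiltonian); $B^H$ is a scalar fractional Brownian motion with Hurst parameter $H$ on $(\Omega,\mathcal F,P)$, $\xi^H_n=B^H(n+1)-B^H(n)$. $\mathcal F_0\subset\mathcal F$ is a sub-$\sigma$-algebra independent of $\{\xi^H_n\}$ and $\mathcal F_n=\mathcal F_0\vee\sigma(\xi^H_0,\dots,\xi^H_{n-1})$. "Adapted" means the $n$-th term is $\mathcal F_n$-measurable. $(\eta_n)$ are the i.i.d. standard normal variables obtained from $(\xi^H_n)$ by Gram–Schmidt orthonormalization, with deterministic coefficients $\alpha,\beta$: $\eta_n=\sum_{k=0}^n\alpha(n,k)\xi^H_k$, $\xi^H_n=\sum_{k=0}^n\beta(n,k)\eta_k$ (and $\alpha(n,k)=\beta(n,k)=0$ for $k>n$). Put $\gamma(n,k)=\sum_{l=0}^{n-1}\beta(n,l)\alpha(l,k)$ (not to be confused with the constant $\gamma$), so that $\mathbb E[\xi^H_n\mid\mathcal F_n]=\sum_{k=0}^{n-1}\gamma(n,k)\xi^H_k$. **Spaces.** Constants: $a>1$, $b_0\ge1$, $\lambda>0$, $\gamma>1$, $\theta>1$; $\delta_n=1-(n+2)^{-\theta}$ for $n\ge1$, $\vec\delta^\theta=(\delta_n)_{n\ge1}$, $|\vec\delta^\theta|=\prod_{i\ge1}\delta_i$. $L^{2a,\vec\delta^\theta,\lambda,\gamma}_{\mathcal F}(0,\infty)$ is the set of adapted $X$ with $\sum_{n\ge0}e^{-\lambda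 n^\gamma}\mathbb E(|X_n|^{2a\delta_1\cdots\delta_n})<\infty$; $\hat L^{2b_0,\vec\delta^\theta,\lambda,\gamma}_{\mathcal F}(0,\infty)$ is the set of adapted $Y$ with $\sum_{n\ge0}e^{-\lambda n^\gamma}\mathbb E(|Y_n|^{2b_0\delta_1^{-1}\cdots\delta_n^{-1}})<\infty$. Solutions of forward equations for the state are taken in the first space; solution pairs of backward equations have both components in the second space. **Control problem** (state and control are one-dimensional). $\mathbb U$ is the set of adapted processes $u=(u_n)_{n\ge0}$ with values in a given closed convex set $\mathbf U\subset\mathbb R$ and $\sum_{n\ge0}e^{-\lambda n^\gamma}\mathbb E(|u_n|^{2a\delta_1\cdots\delta_n})<\infty$. For $u\in\mathbb U$ the state is $$X_{n+1}=X_n+b(n,X_n,u_n)+\sigma(n,X_n,u_n)\xi^H_n,\ n\in\mathcal T,\qquad X_0=x,$$ with $x\in L^{2a}(\mathcal F_0)$ independent of $\{\xi^H_n\}$, and $(Y,Z)$ solves $$e^{-\lambda n^\gamma}(Y_n+Z_n\eta_n)=e^{-\lambda(n+1)^\gamma}\big(Y_{n+1}+f(n+1,X_{n+1},Y_{n+1},Z_{n+1},u_{n+1})\big),\ n\in\mathcal T,$$ $$\lim_{N\to\infty}\mathbb E[e^{-\lambda N^\gamma}|Y_N|^{2b_0\delta_1^{-1}\cdots\delta_N^{-1}}]=0.$$ The cost to be minimized is $J(u)=Y_0$ (read as $\mathbb E[Y_0]$), equivalently $J(u)=\mathbb E\sum_{n\ge1}e^{-\lambda n^\gamma}f(n,X_n,Y_n,Z_n,u_n)$.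 The real-valued (possibly random) functions $b(n,x,u)$, $\sigma(n,x,u)$, $f(n,x,y,z,u)$ are measurable and differentiable in the variables other than $n$. **Assumptions.** (A1) For all real $x,y,z,u$: $b(\cdot,x,u),\sigma(\cdot,x,u)\in L^{2a,\vec\delta^\theta,\lambda,\gamma}_{\mathcal F}(0,\infty)$ and $f(\cdot,x,y,z,u)\in\hat L^{2b_0,\vec\delta^\theta,\lambda,\gamma}_{\mathcal F}(0,\infty)$, adapted, with $a|\vec\delta^\theta|^2\ge b_0\ge1$. (A2) There is $L>0$ with $|b(n,x_1,u_1)-b(n,x_2,u_2)|+|\sigma(n,x_1,u_1)-\sigma(n,x_2,u_2)|\le L(|x_1-x_2|+|u_1-u_2|)$ and $|f(n,x_1,y_1,z_1,u_1)-f(n,x_2,y_2,z_2,u_2)|\le L(|x_1-x_2|+|y_1-y_2|+|z_1-z_2|+|u_1-u_2|)$ for all $n\in\mathcal T$ and all real arguments. (A3) There is a random function $f_1(n,x,y,u)$ with $f_1(\cdot,x,y,u)\in\hat L^{2b_0,\vec\delta^\theta,\lambda,\gamma}_{\mathcal F}(0,\infty)$ and $\lim_{N\to\infty}\mathbb E[e^{-\lambda N^\gamma}|f(N,x,y,z,u)-f_1(N,x,y,u)|^{2b_0\delta_1^{-1}\cdots\delta_N^{-1}}]=0$ for all real $x,y,z,u$; moreover $f_1$ is differentiable and Lipschitz in $(x,y,u)$ uniformly in $n\in\mathcal T$. **Adjoint processes of $u^*$.** Write $l^*(n)=l(n,X^*_n,u^*_n)$ for $l\in\{b_x,\sigma_x,b_u,\sigma_u\}$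 and $h^*(n)=h(n,X^*_n,Y^*_n,Z^*_n,u^*_n)$ for $h\in\{f_x,f_y,f_z,f_u\}$ (subscripts are partial derivatives). Then $k_0=0$, $k_1=-1$, $k_{n+1}=k_n+f_y^*(n)k_n+f_z^*(n)k_n\eta_n$ for $n\ge1$, and $(p,q)$ is the adapted solution of $$e^{-\lambda n^\gamma}(p_n+q_n\eta_n)=e^{-\lambda(n+1)^\gamma}\Big(p_{n+1}+b_x^*(n+1)p_{n+1}+\beta(n+1,n+1)\sigma_x^*(n+1)q_{n+1}-f_x^*(n+1)k_{n+1}+\sigma_x^*(n+1)p_{n+1}\mathbb E[\xi^H_{n+1}\mid\mathcal F_{n+1}]\Big),$$ $n\in\mathcal T$, with $\lim_{N\to\infty}\mathbb E[e^{-\lambda N^\gamma}|p_N|^{2b_0\delta_1^{-1}\cdots\delta_N^{-1}}]=0$. *)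

theory Defs
  imports "HOL-Probability.Probability"
begin

section \<open>Fractional Brownian motion and Gram--Schmidt orthonormalization\<close>

text \<open>Degenerate (almost surely constant) normal variables are admitted, so that linear
  combinations of a Gaussian process are covered.\<close>

definition gaussian_rv :: "'a measure \<Rightarrow> ('a \<Rightarrow> real) \<Rightarrow> bool" where
  "gaussian_rv M X \<longleftrightarrow> X \<in> borel_measurable M \<and>
     ((\<exists>\<mu> s. s > 0 \<and> distributed M lborel X (normal_density \<mu> s)) \<or> (\<exists>\<mu>. AE \<omega> in M. X \<omega> = \<mu>))"

definition gaussian_process :: "'a measure \<Rightarrow> real set \<Rightarrow> (real \<Rightarrow> 'a \<Rightarrow> real) \<Rightarrow> bool" where
  "gaussian_process M T B \<longleftrightarrow>
     (\<forall>I c. finite I \<and> I \<subseteq> T \<longrightarrow> gaussian_rv M (\<lambda>\<omega>. \<Sum>t\<in>I. c t * B t \<omega>))"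

definition fractional_brownian_motion :: "'a measure \<Rightarrow> real \<Rightarrow> (real \<Rightarrow> 'a \<Rightarrow> real) \<Rightarrow> bool" where
  "fractional_brownian_motion M H B \<longleftrightarrow>
     gaussian_process M {0..} B \<and>
     (\<forall>t\<ge>0. (\<integral>\<omega>. B t \<omega> \<partial>M) = 0) \<and>
     (\<forall>s\<ge>0. \<forall>t\<ge>0. (\<integral>\<omega>. B s \<omega> * B t \<omega> \<partial>M)
        = (s powr (2 * H) + t powr (2 * H) - \<bar>t - s\<bar> powr (2 * H)) / 2)"

definition gs_residual ::
  "'a measure \<Rightarrow> (nat \<Rightarrow> 'a \<Rightarrow> real) \<Rightarrow> (nat \<Rightarrow> 'a \<Rightarrow> real) \<Rightarrow> nat \<Rightarrow> 'a \<Rightarrow> real" where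
  "gs_residual M \<xi> \<eta> n \<omega> = \<xi> n \<omega> - (\<Sum>k<n. (\<integral>\<omega>'. \<xi> n \<omega>' * \<eta> k \<omega>' \<partial>M) * \<eta> k \<omega>)"

definition gram_schmidt ::
  "'a measure \<Rightarrow> (nat \<Rightarrow> 'a \<Rightarrow> real) \<Rightarrow> (nat \<Rightarrow> 'a \<Rightarrow> real) \<Rightarrow> bool" where
  "gram_schmidt M \<xi> \<eta> \<longleftrightarrow> (\<forall>n. \<forall>\<omega>\<in>space M.
     \<eta> n \<omega> = gs_residual M \<xi> \<eta> n \<omega> / sqrt (\<integral>\<omega>'. (gs_residual M \<xi> \<eta> n \<omega>')\<^sup>2 \<partial>M))"

section \<open>Data of the control problem\<close>

text \<open>Random coefficients take the time, the sample point and then the real variables: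
  \<open>drift S n \<omega> x u\<close> is $b(n,x,u)$, \<open>vol S n \<omega> x u\<close> is $\sigma(n,x,u)$, and
  \<open>gen S n \<omega> x y z u\<close> is $f(n,x,y,z,u)$. The exponents $a$, $b_0$ are \<open>expa\<close>, \<open>expb\<close>;
  the constants $\lambda$, $\gamma$, $\theta$ are \<open>lam\<close>, \<open>gam\<close>, \<open>tht\<close>.\<close>

record 'a control_problem =
  prb :: "'a measure"
  hurst :: real
  fbm :: "real \<Rightarrow> 'a \<Rightarrow> real"
  init_alg :: "'a measure"
  eta :: "nat \<Rightarrow> 'a \<Rightarrow> real"
  alpha :: "nat \<Rightarrow> nat \<Rightarrow> real"
  beta :: "nat \<Rightarrow> nat \<Rightarrow> real"
  expa :: real
  expb :: real
  lam :: real
  gam :: real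
  tht :: real
  ctrl_set :: "real set"
  init :: "'a \<Rightarrow> real"
  drift :: "nat \<Rightarrow> 'a \<Rightarrow> real \<Rightarrow> real \<Rightarrow> real"
  vol :: "nat \<Rightarrow> 'a \<Rightarrow> real \<Rightarrow> real \<Rightarrow> real"
  gen :: "nat \<Rightarrow> 'a \<Rightarrow> real \<Rightarrow> real \<Rightarrow> real \<Rightarrow> real \<Rightarrow> real"

type_synonym 'a process = "nat \<Rightarrow> 'a \<Rightarrow> real"

definition xi :: "'a control_problem \<Rightarrow> 'a process" where
  "xi S n \<omega> = fbm S (real n + 1) \<omega> - fbm S (real n) \<omega>"

definition filt :: "'a control_problem \<Rightarrow> nat \<Rightarrow> 'a measure" where
  "filt S n = sigma (space (prb S))
     (sets (init_alg S) \<union> {xi S k -` A \<inter> space (prb S) | k A. k < n \<and> A \<in> sets borel})"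

definition gammac :: "'a control_problem \<Rightarrow> nat \<Rightarrow> nat \<Rightarrow> real" where
  "gammac S n k = (\<Sum>l<n. beta S n l * alpha S l k)"

definition cond_xi :: "'a control_problem \<Rightarrow> 'a process" where
  "cond_xi S n = real_cond_exp (prb S) (filt S n) (xi S n)"

section \<open>Weighted spaces of adapted processes\<close>

definition adapted :: "'a control_problem \<Rightarrow> 'a process \<Rightarrow> bool" where
  "adapted S X \<longleftrightarrow> (\<forall>n. X n \<in> borel_measurable (filt S n))"

definition delta :: "'a control_problem \<Rightarrow> nat \<Rightarrow> real" where
  "delta S n = 1 - (real n + 2) powr (- tht S)"

definition delta_prod :: "'a control_problem \<Rightarrow> nat \<Rightarrow> real" where
  "delta_prod S n = (\<Prod>i=1..n. delta S i)"

definition delta_norm :: "'a control_problem \<Rightarrow> real" where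
  "delta_norm S = (\<Prod>i. delta S (Suc i))"

definition wt :: "'a control_problem \<Rightarrow> nat \<Rightarrow> real" where
  "wt S n = exp (- lam S * real n powr gam S)"

definition fwd_exp :: "'a control_problem \<Rightarrow> nat \<Rightarrow> real" where
  "fwd_exp S n = 2 * expa S * delta_prod S n"

definition bwd_exp :: "'a control_problem \<Rightarrow> nat \<Rightarrow> real" where
  "bwd_exp S n = 2 * expb S / delta_prod S n"

definition weighted_space :: "'a control_problem \<Rightarrow> (nat \<Rightarrow> real) \<Rightarrow> 'a process set" where
  "weighted_space S r = {X. adapted S X \<and>
     (\<forall>n. integrable (prb S) (\<lambda>\<omega>. \<bar>X n \<omega>\<bar> powr r n)) \<and>
     summable (\<lambda>n. wt S n * (\<integral>\<omega>. \<bar>X n \<omega>\<bar> powr r n \<partial>prb S))}"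

definition fwd_space :: "'a control_problem \<Rightarrow> 'a process set" where
  "fwd_space S = weighted_space S (fwd_exp S)"

definition bwd_space :: "'a control_problem \<Rightarrow> 'a process set" where
  "bwd_space S = weighted_space S (bwd_exp S)"

definition vanishes :: "'a control_problem \<Rightarrow> 'a process \<Rightarrow> bool" where
  "vanishes S Y \<longleftrightarrow> (\<lambda>N. \<integral>\<omega>. wt S N * \<bar>Y N \<omega>\<bar> powr bwd_exp S N \<partial>prb S) \<longlonglongrightarrow> 0"

section \<open>Standing setup and assumptions (A1)--(A3)\<close>

definition noise_setup :: "'a control_problem \<Rightarrow> bool" where
  "noise_setup S \<longleftrightarrow>
     prob_space (prb S) \<and> 0 < hurst S \<and> hurst S < 1 \<and>
     fractional_brownian_motion (prb S) (hurst S) (fbm S) \<and>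
     subalgebra (prb S) (init_alg S) \<and>
     prob_space.indep_set (prb S) (sets (init_alg S))
       (sigma_sets (space (prb S)) {xi S k -` A \<inter> space (prb S) | k A. A \<in> sets borel}) \<and>
     gram_schmidt (prb S) (xi S) (eta S) \<and>
     prob_space.indep_vars (prb S) (\<lambda>_. borel) (eta S) UNIV \<and>
     (\<forall>n. distributed (prb S) lborel (eta S n) std_normal_density) \<and>
     (\<forall>n. \<forall>\<omega>\<in>space (prb S). eta S n \<omega> = (\<Sum>k\<le>n. alpha S n k * xi S k \<omega>)) \<and>
     (\<forall>n. \<forall>\<omega>\<in>space (prb S). xi S n \<omega> = (\<Sum>k\<le>n. beta S n k * eta S k \<omega>)) \<and>
     (\<forall>n k. k > n \<longrightarrow> alpha S n k = 0 \<and> beta S n k = 0)"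

definition coefficient_setup :: "'a control_problem \<Rightarrow> bool" where
  "coefficient_setup S \<longleftrightarrow>
     expa S > 1 \<and> expb S \<ge> 1 \<and> lam S > 0 \<and> gam S > 1 \<and> tht S > 1 \<and>
     closed (ctrl_set S) \<and> convex (ctrl_set S) \<and>
     init S \<in> borel_measurable (init_alg S) \<and>
     integrable (prb S) (\<lambda>\<omega>. \<bar>init S \<omega>\<bar> powr (2 * expa S)) \<and>
     (\<forall>n. (\<lambda>(\<omega>, x, u). drift S n \<omega> x u) \<in> borel_measurable (prb S \<Otimes>\<^sub>M borel \<Otimes>\<^sub>M borel)) \<and>
     (\<forall>n. (\<lambda>(\<omega>, x, u). vol S n \<omega> x u) \<in> borel_measurable (prb S \<Otimes>\<^sub>M borel \<Otimes>\<^sub>M borel)) \<and>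
     (\<forall>n. (\<lambda>(\<omega>, x, y, z, u). gen S n \<omega> x y z u)
        \<in> borel_measurable (prb S \<Otimes>\<^sub>M borel \<Otimes>\<^sub>M borel \<Otimes>\<^sub>M borel \<Otimes>\<^sub>M borel)) \<and>
     (\<forall>n. \<forall>\<omega>\<in>space (prb S).
        (\<forall>v. (\<lambda>(x, u). drift S n \<omega> x u) differentiable (at v)) \<and>
        (\<forall>v. (\<lambda>(x, u). vol S n \<omega> x u) differentiable (at v)) \<and>
        (\<forall>v. (\<lambda>(x, y, z, u). gen S n \<omega> x y z u) differentiable (at v)))"

definition A1 :: "'a control_problem \<Rightarrow> bool" where
  "A1 S \<longleftrightarrow>
     (\<forall>x u. (\<lambda>n \<omega>. drift S n \<omega> x u) \<in> fwd_space S \<and> (\<lambda>n \<omega>. vol S n \<omega> x u) \<in> fwd_space S) \<and>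
     (\<forall>x y z u. (\<lambda>n \<omega>. gen S n \<omega> x y z u) \<in> bwd_space S) \<and>
     expa S * (delta_norm S)\<^sup>2 \<ge> expb S \<and> expb S \<ge> 1"

definition A2 :: "'a control_problem \<Rightarrow> bool" where
  "A2 S \<longleftrightarrow> (\<exists>L>0. \<forall>n. \<forall>\<omega>\<in>space (prb S).
     (\<forall>x1 x2 u1 u2.
        \<bar>drift S n \<omega> x1 u1 - drift S n \<omega> x2 u2\<bar> + \<bar>vol S n \<omega> x1 u1 - vol S n \<omega> x2 u2\<bar>
          \<le> L * (\<bar>x1 - x2\<bar> + \<bar>u1 - u2\<bar>)) \<and>
     (\<forall>x1 x2 y1 y2 z1 z2 u1 u2.
        \<bar>gen S n \<omega> x1 y1 z1 u1 - gen S n \<omega> x2 y2 z2 u2\<bar>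
          \<le> L * (\<bar>x1 - x2\<bar> + \<bar>y1 - y2\<bar> + \<bar>z1 - z2\<bar> + \<bar>u1 - u2\<bar>)))"

definition A3 :: "'a control_problem \<Rightarrow> bool" where
  "A3 S \<longleftrightarrow> (\<exists>f1 :: nat \<Rightarrow> 'a \<Rightarrow> real \<Rightarrow> real \<Rightarrow> real \<Rightarrow> real.
     (\<forall>x y u. (\<lambda>n \<omega>. f1 n \<omega> x y u) \<in> bwd_space S) \<and>
     (\<forall>x y z u. vanishes S (\<lambda>n \<omega>. gen S n \<omega> x y z u - f1 n \<omega> x y u)) \<and>
     (\<forall>n. \<forall>\<omega>\<in>space (prb S). \<forall>v. (\<lambda>(x, y, u). f1 n \<omega> x y u) differentiable (at v)) \<and>
     (\<exists>L>0. \<forall>n. \<forall>\<omega>\<in>space (prb S). \<forall>x1 x2 y1 y2 u1 u2.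
        \<bar>f1 n \<omega> x1 y1 u1 - f1 n \<omega> x2 y2 u2\<bar> \<le> L * (\<bar>x1 - x2\<bar> + \<bar>y1 - y2\<bar> + \<bar>u1 - u2\<bar>)))"

section \<open>Controls, controlled system and cost\<close>

definition controls :: "'a control_problem \<Rightarrow> 'a process set" where
  "controls S = {u \<in> fwd_space S. \<forall>n. \<forall>\<omega>\<in>space (prb S). u n \<omega> \<in> ctrl_set S}"

definition state_solution :: "'a control_problem \<Rightarrow> 'a process \<Rightarrow> 'a process \<Rightarrow> bool" where
  "state_solution S u X \<longleftrightarrow> X \<in> fwd_space S \<and>
     (AE \<omega> in prb S. X 0 \<omega> = init S \<omega>) \<and>
     (\<forall>n. AE \<omega> in prb S. X (Suc n) \<omega> =
        X n \<omega> + drift S n \<omega> (X n \<omega>) (u n \<omega>) + vol S n \<omega> (X n \<omega>) (u n \<omega>) * xi S n \<omega>)"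

definition backward_solution ::
  "'a control_problem \<Rightarrow> 'a process \<Rightarrow> 'a process \<Rightarrow> 'a process \<Rightarrow> 'a process \<Rightarrow> bool" where
  "backward_solution S u X Y Z \<longleftrightarrow> Y \<in> bwd_space S \<and> Z \<in> bwd_space S \<and>
     (\<forall>n. AE \<omega> in prb S. wt S n * (Y n \<omega> + Z n \<omega> * eta S n \<omega>) =
        wt S (Suc n) * (Y (Suc n) \<omega> +
          gen S (Suc n) \<omega> (X (Suc n) \<omega>) (Y (Suc n) \<omega>) (Z (Suc n) \<omega>) (u (Suc n) \<omega>))) \<and>
     vanishes S Y"

definition system_solution ::
  "'a control_problem \<Rightarrow> 'a process \<Rightarrow> 'a process \<Rightarrow> 'a process \<Rightarrow> 'a process \<Rightarrow> bool" where
  "system_solution S u X Y Z \<longleftrightarrow> state_solution S u X \<and> backward_solution S u X Y Z"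

text \<open>Under A1 and A2 $Y_0$ has the same expectation for all solutions belonging to $u$, so the infimum only
  selects it; it is taken over all solutions so that no choice is involved, and it is $+\infty$
  for a control whose system has no solution.\<close>

definition J :: "'a control_problem \<Rightarrow> 'a process \<Rightarrow> ereal" where
  "J S u = (INF (X, Y, Z) \<in> {(X, Y, Z). system_solution S u X Y Z}. ereal (\<integral>\<omega>. Y 0 \<omega> \<partial>prb S))"

section \<open>Adjoint processes and Hamiltonian\<close>

definition drift_x :: "'a control_problem \<Rightarrow> 'a process \<Rightarrow> 'a process \<Rightarrow> 'a process" where
  "drift_x S u X n \<omega> = deriv (\<lambda>x. drift S n \<omega> x (u n \<omega>)) (X n \<omega>)"

definition drift_u :: "'a control_problem \<Rightarrow> 'a process \<Rightarrow> 'a process \<Rightarrow> 'a process" where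
  "drift_u S u X n \<omega> = deriv (\<lambda>v. drift S n \<omega> (X n \<omega>) v) (u n \<omega>)"

definition vol_x :: "'a control_problem \<Rightarrow> 'a process \<Rightarrow> 'a process \<Rightarrow> 'a process" where
  "vol_x S u X n \<omega> = deriv (\<lambda>x. vol S n \<omega> x (u n \<omega>)) (X n \<omega>)"

definition vol_u :: "'a control_problem \<Rightarrow> 'a process \<Rightarrow> 'a process \<Rightarrow> 'a process" where
  "vol_u S u X n \<omega> = deriv (\<lambda>v. vol S n \<omega> (X n \<omega>) v) (u n \<omega>)"

definition gen_x ::
  "'a control_problem \<Rightarrow> 'a process \<Rightarrow> 'a process \<Rightarrow> 'a process \<Rightarrow> 'a process \<Rightarrow> 'a process" where
  "gen_x S u X Y Z n \<omega> = deriv (\<lambda>x. gen S n \<omega> x (Y n \<omega>) (Z n \<omega>) (u n \<omega>)) (X n \<omega>)"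

definition gen_y ::
  "'a control_problem \<Rightarrow> 'a process \<Rightarrow> 'a process \<Rightarrow> 'a process \<Rightarrow> 'a process \<Rightarrow> 'a process" where
  "gen_y S u X Y Z n \<omega> = deriv (\<lambda>y. gen S n \<omega> (X n \<omega>) y (Z n \<omega>) (u n \<omega>)) (Y n \<omega>)"

definition gen_z ::
  "'a control_problem \<Rightarrow> 'a process \<Rightarrow> 'a process \<Rightarrow> 'a process \<Rightarrow> 'a process \<Rightarrow> 'a process" where
  "gen_z S u X Y Z n \<omega> = deriv (\<lambda>z. gen S n \<omega> (X n \<omega>) (Y n \<omega>) z (u n \<omega>)) (Z n \<omega>)"

definition gen_u ::
  "'a control_problem \<Rightarrow> 'a process \<Rightarrow> 'a process \<Rightarrow> 'a process \<Rightarrow> 'a process \<Rightarrow> 'a process" where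
  "gen_u S u X Y Z n \<omega> = deriv (\<lambda>v. gen S n \<omega> (X n \<omega>) (Y n \<omega>) (Z n \<omega>) v) (u n \<omega>)"

definition adjoint_forward ::
  "'a control_problem \<Rightarrow> 'a process \<Rightarrow> 'a process \<Rightarrow> 'a process \<Rightarrow> 'a process \<Rightarrow> 'a process \<Rightarrow> bool" where
  "adjoint_forward S u X Y Z k \<longleftrightarrow>
     (AE \<omega> in prb S. k 0 \<omega> = 0) \<and>
     (AE \<omega> in prb S. k 1 \<omega> = -1) \<and>
     (\<forall>n\<ge>1. AE \<omega> in prb S. k (Suc n) \<omega> =
        k n \<omega> + gen_y S u X Y Z n \<omega> * k n \<omega> + gen_z S u X Y Z n \<omega> * k n \<omega> * eta S n \<omega>)"

definition adjoint_backward ::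
  "'a control_problem \<Rightarrow> 'a process \<Rightarrow> 'a process \<Rightarrow> 'a process \<Rightarrow> 'a process \<Rightarrow> 'a process
    \<Rightarrow> 'a process \<Rightarrow> 'a process \<Rightarrow> bool" where
  "adjoint_backward S u X Y Z k p q \<longleftrightarrow> p \<in> bwd_space S \<and> q \<in> bwd_space S \<and>
     (\<forall>n. AE \<omega> in prb S. wt S n * (p n \<omega> + q n \<omega> * eta S n \<omega>) =
        wt S (Suc n) * (p (Suc n) \<omega>
          + drift_x S u X (Suc n) \<omega> * p (Suc n) \<omega>
          + beta S (Suc n) (Suc n) * vol_x S u X (Suc n) \<omega> * q (Suc n) \<omega>
          - gen_x S u X Y Z (Suc n) \<omega> * k (Suc n) \<omega>
          + vol_x S u X (Suc n) \<omega> * p (Suc n) \<omega> * cond_xi S (Suc n) \<omega>)) \<and>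
     vanishes S p"

definition hamiltonian ::
  "'a control_problem \<Rightarrow> nat \<Rightarrow> 'a \<Rightarrow> real \<Rightarrow> real \<Rightarrow> real \<Rightarrow> real \<Rightarrow> real \<Rightarrow> real \<Rightarrow> real \<Rightarrow> real" where
  "hamiltonian S n \<omega> x y z u p q k =
     drift S n \<omega> x u * p + vol S n \<omega> x u * p * cond_xi S n \<omega>
       + beta S n n * vol S n \<omega> x u * q - gen S n \<omega> x y z u * k"

end

theory Submission
  imports Defs
begin

text \<open>Let \<open>(X, Y, Z)\<close> be any solution for any control \<open>u\<close>, and write \<open>dX = X - X*\<close>, etc.
  Pairing the backward equation for \<open>dY\<close> with \<open>k\<close>, and that for \<open>p\<close> with \<open>dX\<close>, uses only that
  \<open>\<eta>\<^sub>n\<close> is standard normal and independent of the past. With \<open>G\<close> the driver of the equation for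
  \<open>p\<close>, the quantities \<open>T n = w\<^sub>n E[k (dY + df)]\<close> and \<open>R n = w\<^sub>n E[dX (p + G)]\<close> satisfy
  \<open>T (n+1) + R (n+1) - T n - R n = w\<^sub>n E[H - H* - H\<^sub>x dX - H\<^sub>y dY - H\<^sub>z dZ]\<close>,
  which is nonnegative by convexity and the variational inequality. Both tend to 0, because the
  exponents are at least 2 and \<open>w\<^sub>n\<close> decays faster than any exponential; hence \<open>T 1 + R 1 \<le> 0\<close>. Since
  \<open>T 1 = - E[dY 0]\<close> and \<open>R 1 \<ge> 0\<close>, the cost of \<open>u\<close> is at least that of \<open>u*\<close>. Taking \<open>u = u*\<close>
  also shows that the infimum in the definition of the cost is attained by the given solution.\<close>

section \<open>Calculus\<close>

text \<open>The increments \<open>xi\<close> are in general correlated over time, so the noise term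
  of the state equation is not centred given the past. The remedy is to split \<open>xi n\<close>
  into \<open>xi_pred n\<close>, a combination of earlier innovations, and the fresh term
  \<open>beta S n n * eta S n\<close>. The conditional expectation in the Hamiltonian and the
  \<open>gammac\<close> sum in the variational inequality are both this predictable part. The price
  is an unbounded Gaussian factor in products such as \<open>dX * xi_pred\<close>, for which second
  moments of \<open>dX\<close> do not suffice. The condition in \<open>A1\<close> linking
  \<open>expa\<close>, \<open>expb\<close> and \<open>delta_norm\<close> keeps the forward exponents
  uniformly above 2; this margin and a uniform bound on \<open>beta\<close> pay for the factor.
  Weighted squares, rather than conjugate exponents, put all processes of the pairing into one
  class. The increment inequality for \<open>T + R\<close> is used from time 1 on, because the value
  -1 of \<open>k\<close> at time 1 does not come from its value 0 at time 0 by the recursion. The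
  passage from 0 to 1 is computed separately and is what brings in the initial cost.\<close>

text \<open>Simple functions approximating \<open>V\<close> take finitely many values, so
  substituting them keeps measurability, and continuity of \<open>g\<close> passes to the limit.
  This is what makes a coefficient evaluated along adapted processes adapted: joint measurability
  over the whole probability space would say nothing about the filtration.\<close>

lemma borel_measurable_Caratheodory:
  fixes g :: "'a \<Rightarrow> 'b::{metric_space, second_countable_topology} \<Rightarrow> 'c::metric_space"
  assumes g: "\<And>v. (\<lambda>\<omega>. g \<omega> v) \<in> borel_measurable M"
    and V: "V \<in> borel_measurable M"
    and cont: "\<And>\<omega>. \<omega> \<in> space M \<Longrightarrow> continuous_on UNIV (g \<omega>)"
  shows "(\<lambda>\<omega>. g \<omega> (V \<omega>)) \<in> borel_measurable M"
proof -
  obtain F where F: "\<And>i. simple_function M (F i)"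
    and lim: "\<And>\<omega>. \<omega> \<in> space M \<Longrightarrow> (\<lambda>i. F i \<omega>) \<longlonglongrightarrow> V \<omega>"
    using borel_measurable_implies_sequence_metric[OF V] by metis
  show ?thesis
  proof (rule borel_measurable_LIMSEQ_metric)
    fix i
    show "(\<lambda>\<omega>. g \<omega> (F i \<omega>)) \<in> borel_measurable M"
    proof (rule measurable_compose_countable'[where f = "\<lambda>v \<omega>. g \<omega> v" and I = "F i ` space M"])
      show "F i \<in> measurable M (count_space (F i ` space M))"
        using F[of i] by (subst measurable_count_space_eq2) (auto simp: simple_function_def)
      show "countable (F i ` space M)"
        using F[of i] by (simp add: simple_function_def countable_finite)
    qed (rule g)
  next
    fix \<omega> assume \<omega>: "\<omega> \<in> space M"
    have "isCont (g \<omega>) (V \<omega>)"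
      using cont[OF \<omega>] by (simp add: continuous_on_eq_continuous_at)
    then show "(\<lambda>i. g \<omega> (F i \<omega>)) \<longlonglongrightarrow> g \<omega> (V \<omega>)"
      using lim[OF \<omega>] isCont_tendsto_compose by blast
  qed
qed

text \<open>One fixed sequence of difference quotients serves twice: measurability of a derivative
  and its Lipschitz bound are both inherited by a sequential limit.\<close>

lemma real_differentiable_LIMSEQ_deriv:
  fixes g :: "real \<Rightarrow> real"
  assumes "g differentiable (at x)"
  shows "(\<lambda>m. (g (x + 1 / real (Suc m)) - g x) * real (Suc m)) \<longlonglongrightarrow> deriv g x"
proof -
  have "DERIV g x :> deriv g x"
    using assms by (simp add: DERIV_deriv_iff_real_differentiable)
  then have "(\<lambda>h. (g (x + h) - g x) / h) \<midarrow>0\<rightarrow> deriv g x"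
    by (simp add: DERIV_def)
  moreover have "filterlim (\<lambda>m. 1 / real (Suc m)) (at 0) sequentially"
    using LIMSEQ_inverse_real_of_nat by (simp add: filterlim_at inverse_eq_divide)
  ultimately have "(\<lambda>m. (g (x + 1 / real (Suc m)) - g x) / (1 / real (Suc m))) \<longlonglongrightarrow> deriv g x"
    by (rule filterlim_compose)
  then show ?thesis by simp
qed

text \<open>The hypothesis on \<open>g\<close> is phrased through substituted random variables
  \<open>W\<close>, which is the form in which adaptedness of the coefficients is available.\<close>

lemma borel_measurable_deriv_at:
  fixes g :: "'a \<Rightarrow> real \<Rightarrow> real"
  assumes g: "\<And>W. W \<in> borel_measurable M \<Longrightarrow> (\<lambda>\<omega>. g \<omega> (W \<omega>)) \<in> borel_measurable M"
    and [measurable]: "V \<in> borel_measurable M"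
    and diff: "\<And>\<omega>. \<omega> \<in> space M \<Longrightarrow> g \<omega> differentiable (at (V \<omega>))"
  shows "(\<lambda>\<omega>. deriv (g \<omega>) (V \<omega>)) \<in> borel_measurable M"
proof (rule borel_measurable_LIMSEQ_real)
  show "(\<lambda>m. (g \<omega> (V \<omega> + 1 / real (Suc m)) - g \<omega> (V \<omega>)) * real (Suc m)) \<longlonglongrightarrow> deriv (g \<omega>) (V \<omega>)"
    if "\<omega> \<in> space M" for \<omega>
    using real_differentiable_LIMSEQ_deriv[OF diff[OF that]] .
  show "(\<lambda>\<omega>. (g \<omega> (V \<omega> + 1 / real (Suc m)) - g \<omega> (V \<omega>)) * real (Suc m)) \<in> borel_measurable M" for m
    by (intro borel_measurable_times borel_measurable_diff g) measurable
qed

lemma abs_deriv_le_Lipschitz: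
  fixes g :: "real \<Rightarrow> real"
  assumes "g differentiable (at x)" and lip: "\<And>s t. \<bar>g s - g t\<bar> \<le> L * \<bar>s - t\<bar>"
  shows "\<bar>deriv g x\<bar> \<le> L"
proof (rule tendsto_upperbound[OF tendsto_rabs[OF real_differentiable_LIMSEQ_deriv[OF assms(1)]]])
  show "\<forall>\<^sub>F m in sequentially. \<bar>(g (x + 1 / real (Suc m)) - g x) * real (Suc m)\<bar> \<le> L"
  proof (rule always_eventually, rule allI)
    fix m
    have "\<bar>g (x + 1 / real (Suc m)) - g x\<bar> \<le> L * (1 / real (Suc m))"
      using lip[of "x + 1 / real (Suc m)" x] by simp
    then have "\<bar>g (x + 1 / real (Suc m)) - g x\<bar> * real (Suc m) \<le> L"
      by (simp add: field_simps)
    then show "\<bar>(g (x + 1 / real (Suc m)) - g x) * real (Suc m)\<bar> \<le> L"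
      by (simp add: abs_mult)
  qed
qed simp

section \<open>Tangent planes and total derivatives in terms of partial ones\<close>

text \<open>On the line through \<open>v\<close> and \<open>w\<close> this is the one-dimensional
  tangent inequality between the parameters 0 and 1.\<close>

lemma convex_on_imp_above_tangent_plane:
  fixes h :: "'b::real_normed_vector \<Rightarrow> real"
  assumes conv: "convex_on UNIV h" and D: "(h has_derivative D) (at v)"
  shows "h v + D (w - v) \<le> h w"
proof -
  let ?g = "\<lambda>t. h (v + t *\<^sub>R (w - v))"
  have line: "((\<lambda>t. v + t *\<^sub>R (w - v)) has_derivative (\<lambda>t. t *\<^sub>R (w - v))) (at 0)"
    by (auto intro!: derivative_eq_intros)
  have "(?g has_derivative (\<lambda>t. D (t *\<^sub>R (w - v)))) (at 0)"
    using has_derivative_compose[OF line, of h D] D by simp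
  then have "(?g has_field_derivative D (w - v)) (at 0)"
    unfolding has_field_derivative_def
    by (simp add: linear_cmul[OF has_derivative_linear[OF D]] mult_commute_abs)
  moreover have "convex_on UNIV ?g"
  proof (rule convex_onI)
    fix t x y :: real assume t: "0 < t" "t < 1"
    have eq: "v + ((1 - t) *\<^sub>R x + t *\<^sub>R y) *\<^sub>R (w - v)
        = (1 - t) *\<^sub>R (v + x *\<^sub>R (w - v)) + t *\<^sub>R (v + y *\<^sub>R (w - v))"
      by (simp add: algebra_simps)
    show "?g ((1 - t) *\<^sub>R x + t *\<^sub>R y) \<le> (1 - t) * ?g x + t * ?g y"
      unfolding eq using t by (intro convex_onD[OF conv]) auto
  qed simp
  ultimately have "D (w - v) * (1 - 0) \<le> ?g 1 - ?g 0"
    by (intro convex_on_imp_above_tangent[where A = UNIV]) auto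
  then show ?thesis by simp
qed

text \<open>Here \<open>i\<close> is meant to be a coordinate line through the base point and
  \<open>j\<close> its direction. The lemma links the total differentiability assumed of the
  coefficients to the \<open>deriv\<close> terms in the adjoint equations.\<close>

lemma has_derivative_imp_partial_deriv:
  fixes f :: "'b::real_normed_vector \<Rightarrow> real"
  assumes D: "(f has_derivative D) (at (i x))"
    and i: "(i has_derivative j) (at x)"
  shows "(\<lambda>t. f (i t)) differentiable (at x)" "deriv (\<lambda>t. f (i t)) x = D (j 1)"
proof -
  have d: "((\<lambda>t. f (i t)) has_derivative (\<lambda>t. D (j t))) (at x)"
    using has_derivative_compose[OF i D] .
  then show "(\<lambda>t. f (i t)) differentiable (at x)"
    by (rule differentiableI)
  have "(\<lambda>t. D (j t)) = (*) (D (j 1))"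
  proof
    fix t
    have "D (j (t *\<^sub>R 1)) = t *\<^sub>R D (j 1)"
      by (rule linear_cmul[OF has_derivative_linear[OF d]])
    then show "D (j t) = D (j 1) * t" by (simp add: mult.commute)
  qed
  then have "DERIV (\<lambda>t. f (i t)) x :> D (j 1)"
    using d by (simp only: has_field_derivative_def)
  then show "deriv (\<lambda>t. f (i t)) x = D (j 1)"
    by (rule DERIV_imp_deriv)
qed

lemma has_derivative_partials2:
  fixes g :: "real \<Rightarrow> real \<Rightarrow> real"
  assumes "(\<lambda>(x, u). g x u) differentiable (at (x0, u0))"
  shows "((\<lambda>(x, u). g x u) has_derivative
            (\<lambda>(s, t). s * deriv (\<lambda>x. g x u0) x0 + t * deriv (g x0) u0)) (at (x0, u0))"
    and "(\<lambda>x. g x u0) differentiable (at x0)"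
proof -
  obtain D where D: "((\<lambda>(x, u). g x u) has_derivative D) (at (x0, u0))"
    using assms by (auto simp: differentiable_def)
  have 1: "((\<lambda>x. (x, u0)) has_derivative (\<lambda>s. (s, 0))) (at x0)"
    by (auto intro!: derivative_eq_intros)
  have 2: "((\<lambda>u. (x0, u)) has_derivative (\<lambda>s. (0, s))) (at u0)"
    by (auto intro!: derivative_eq_intros)
  note p1 = has_derivative_imp_partial_deriv[of _ D "\<lambda>x. (x, u0)", OF D 1, simplified]
  note p2 = has_derivative_imp_partial_deriv[of _ D "\<lambda>u. (x0, u)", OF D 2, simplified]
  have lin: "linear D" by (rule has_derivative_linear[OF D])
  have "D (s, t) = s * deriv (\<lambda>x. g x u0) x0 + t * deriv (g x0) u0" for s t
  proof -
    have "D (s, t) = D (s *\<^sub>R (1, 0) + t *\<^sub>R (0, 1))" by simp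
    also have "\<dots> = s *\<^sub>R D (1, 0) + t *\<^sub>R D (0, 1)"
      by (simp only: linear_add[OF lin] linear_cmul[OF lin])
    finally show ?thesis by (simp only: p1(2) p2(2) real_scaleR_def)
  qed
  then have "D = (\<lambda>(s, t). s * deriv (\<lambda>x. g x u0) x0 + t * deriv (g x0) u0)"
    by (auto simp: fun_eq_iff)
  then show "((\<lambda>(x, u). g x u) has_derivative
            (\<lambda>(s, t). s * deriv (\<lambda>x. g x u0) x0 + t * deriv (g x0) u0)) (at (x0, u0))"
    using D by simp
  show "(\<lambda>x. g x u0) differentiable (at x0)"
    by (rule p1(1))
qed

lemma has_derivative_partials4:
  fixes g :: "real \<Rightarrow> real \<Rightarrow> real \<Rightarrow> real \<Rightarrow> real"
  assumes "(\<lambda>(x, y, z, u). g x y z u) differentiable (at (x0, y0, z0, u0))"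
  shows "((\<lambda>(x, y, z, u). g x y z u) has_derivative
            (\<lambda>(s, r, q, t). s * deriv (\<lambda>x. g x y0 z0 u0) x0 + r * deriv (\<lambda>y. g x0 y z0 u0) y0
               + q * deriv (\<lambda>z. g x0 y0 z u0) z0 + t * deriv (g x0 y0 z0) u0)) (at (x0, y0, z0, u0))"
    and "(\<lambda>x. g x y0 z0 u0) differentiable (at x0)" and "(\<lambda>y. g x0 y z0 u0) differentiable (at y0)"
    and "(\<lambda>z. g x0 y0 z u0) differentiable (at z0)"
proof -
  obtain D where D: "((\<lambda>(x, y, z, u). g x y z u) has_derivative D) (at (x0, y0, z0, u0))"
    using assms by (auto simp: differentiable_def)
  have i: "((\<lambda>x. (x, y0, z0, u0)) has_derivative (\<lambda>s. (s, 0, 0, 0))) (at x0)"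
    "((\<lambda>y. (x0, y, z0, u0)) has_derivative (\<lambda>s. (0, s, 0, 0))) (at y0)"
    "((\<lambda>z. (x0, y0, z, u0)) has_derivative (\<lambda>s. (0, 0, s, 0))) (at z0)"
    "((\<lambda>u. (x0, y0, z0, u)) has_derivative (\<lambda>s. (0, 0, 0, s))) (at u0)"
    by (auto intro!: derivative_eq_intros simp: zero_prod_def)
  note p1 = has_derivative_imp_partial_deriv[of _ D "\<lambda>x. (x, y0, z0, u0)", OF D i(1), simplified]
  note p2 = has_derivative_imp_partial_deriv[of _ D "\<lambda>y. (x0, y, z0, u0)", OF D i(2), simplified]
  note p3 = has_derivative_imp_partial_deriv[of _ D "\<lambda>z. (x0, y0, z, u0)", OF D i(3), simplified]
  note p4 = has_derivative_imp_partial_deriv[of _ D "\<lambda>u. (x0, y0, z0, u)", OF D i(4), simplified]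
  have lin: "linear D" by (rule has_derivative_linear[OF D])
  have "D (s, r, q, t) = s * deriv (\<lambda>x. g x y0 z0 u0) x0 + r * deriv (\<lambda>y. g x0 y z0 u0) y0
               + q * deriv (\<lambda>z. g x0 y0 z u0) z0 + t * deriv (g x0 y0 z0) u0"
    for s r q t
  proof -
    have "D (s, r, q, t) = D (s *\<^sub>R (1, 0, 0, 0) + r *\<^sub>R (0, 1, 0, 0) + q *\<^sub>R (0, 0, 1, 0) + t *\<^sub>R (0, 0, 0, 1))"
      by simp
    also have "\<dots> = s *\<^sub>R D (1, 0, 0, 0) + r *\<^sub>R D (0, 1, 0, 0) + q *\<^sub>R D (0, 0, 1, 0) + t *\<^sub>R D (0, 0, 0, 1)"
      by (simp only: linear_add[OF lin] linear_cmul[OF lin])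
    finally show ?thesis by (simp only: p1(2) p2(2) p3(2) p4(2) real_scaleR_def)
  qed
  then have "D = (\<lambda>(s, r, q, t). s * deriv (\<lambda>x. g x y0 z0 u0) x0 + r * deriv (\<lambda>y. g x0 y z0 u0) y0
               + q * deriv (\<lambda>z. g x0 y0 z u0) z0 + t * deriv (g x0 y0 z0) u0)"
    by (auto simp: fun_eq_iff)
  then show "((\<lambda>(x, y, z, u). g x y z u) has_derivative
            (\<lambda>(s, r, q, t). s * deriv (\<lambda>x. g x y0 z0 u0) x0 + r * deriv (\<lambda>y. g x0 y z0 u0) y0
               + q * deriv (\<lambda>z. g x0 y0 z u0) z0 + t * deriv (g x0 y0 z0) u0)) (at (x0, y0, z0, u0))"
    using D by simp
  show "(\<lambda>x. g x y0 z0 u0) differentiable (at x0)" "(\<lambda>y. g x0 y z0 u0) differentiable (at y0)"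
    "(\<lambda>z. g x0 y0 z u0) differentiable (at z0)"
    by (rule p1(1) p2(1) p3(1))+
qed

section \<open>Inequalities that trade exponents, and decay of the weight\<close>

text \<open>A Young-type inequality whose second exponent is an even integer, because those are the
  Gaussian moments known explicitly. Either \<open>c\<close> controls \<open>x\<close> through a
  power, or the surplus \<open>r - 2\<close> in the exponent of \<open>x\<close> absorbs the square
  of \<open>c\<close>.\<close>

lemma square_mult_le_powr_plus_power:
  fixes r :: real
  assumes r: "2 < r"
  shows "\<exists>m>0. \<forall>x c :: real. (x * c)\<^sup>2 \<le> 1 + \<bar>x\<bar> powr r + c ^ (2 * m)"
proof -
  \<comment> \<open>With m (r - 2) at least 2, the case |c|^m < |x|, |c| > 1 gives c^2 \<le>
    |x|^(r-2). The exponent is then raised to m + 1, since in the opposite case (x c)^2 is at most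
    |c|^(2m+2).\<close>
  obtain m :: nat where m: "2 / (r - 2) \<le> real m"
    using real_arch_simple by blast
  then have m2: "2 \<le> real m * (r - 2)" using r by (simp add: field_simps)
  have "(x * c)\<^sup>2 \<le> 1 + \<bar>x\<bar> powr r + c ^ (2 * (m + 1))" for x c :: real
  proof -
    have pow: "0 \<le> c ^ (2 * (m + 1))" "0 \<le> \<bar>x\<bar> powr r"
      by (rule zero_le_even_power, simp) (rule powr_ge_zero)
    have sq: "\<bar>x\<bar> powr 2 = x\<^sup>2"
      by simp
    consider "\<bar>c\<bar> \<le> 1" | "1 < \<bar>c\<bar>" "\<bar>x\<bar> \<le> \<bar>c\<bar> ^ m" | "1 < \<bar>c\<bar>" "\<bar>c\<bar> ^ m < \<bar>x\<bar>"
      by (meson linorder_not_less)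
    then show ?thesis
    proof cases
      case 1
      have "(x * c)\<^sup>2 \<le> x\<^sup>2"
        using 1 by (simp add: power_mult_distrib mult_left_le abs_square_le_1)
      also have "x\<^sup>2 \<le> 1 + \<bar>x\<bar> powr r"
      proof (cases "\<bar>x\<bar> \<le> 1")
        case True
        then have "x\<^sup>2 \<le> 1" by (simp add: abs_square_le_1)
        then show ?thesis using pow by linarith
      next
        case False
        then have "\<bar>x\<bar> powr 2 \<le> \<bar>x\<bar> powr r" using r by (intro powr_mono) auto
        then show ?thesis using sq by linarith
      qed
      finally show ?thesis using pow by linarith
    next
      case 2
      have "x\<^sup>2 \<le> (\<bar>c\<bar> ^ m)\<^sup>2" using 2 power_mono[of "\<bar>x\<bar>" "\<bar>c\<bar> ^ m" 2] by simp
      then have "x\<^sup>2 * c\<^sup>2 \<le> (\<bar>c\<bar> ^ m)\<^sup>2 * c\<^sup>2" by (rule mult_right_mono) simp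
      also have "(\<bar>c\<bar> ^ m)\<^sup>2 = (c\<^sup>2) ^ m"
        by (subst power_mult[symmetric], subst mult.commute, subst power_mult) simp
      also have "\<dots> * c\<^sup>2 = (c\<^sup>2) ^ (m + 1)" by simp
      also have "\<dots> = c ^ (2 * (m + 1))" by (rule power_mult[symmetric])
      finally have "(x * c)\<^sup>2 \<le> c ^ (2 * (m + 1))" by (simp add: power_mult_distrib)
      then show ?thesis using pow by linarith
    next
      case 3
      then have x: "1 < \<bar>x\<bar>" using one_le_power[of "\<bar>c\<bar>" m] by linarith
      have "c\<^sup>2 = \<bar>c\<bar> powr 2" by simp
      also have "\<dots> \<le> \<bar>c\<bar> powr (real m * (r - 2))" using 3 m2 by (intro powr_mono) auto
      also have "\<dots> = (\<bar>c\<bar> powr real m) powr (r - 2)" by (simp only: powr_powr)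
      also have "\<bar>c\<bar> powr real m = \<bar>c\<bar> ^ m" using 3 by (intro powr_realpow) auto
      also have "\<dots> powr (r - 2) \<le> \<bar>x\<bar> powr (r - 2)" using 3 r by (intro powr_mono2) auto
      finally have "x\<^sup>2 * c\<^sup>2 \<le> \<bar>x\<bar> powr 2 * \<bar>x\<bar> powr (r - 2)"
        unfolding sq by (rule mult_left_mono) simp
      also have "\<dots> = \<bar>x\<bar> powr (2 + (r - 2))" by (rule powr_add[symmetric])
      finally have "(x * c)\<^sup>2 \<le> \<bar>x\<bar> powr r" by (simp add: power_mult_distrib)
      then show ?thesis using pow by linarith
    qed
  qed
  then show ?thesis by (intro exI[of _ "m + 1"]) simp
qed

lemma powr_le_one_plus_powr:
  fixes x :: real
  assumes "0 \<le> s" "s \<le> r"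
  shows "\<bar>x\<bar> powr s \<le> 1 + \<bar>x\<bar> powr r"
proof (cases "\<bar>x\<bar> \<le> 1")
  case True
  then have "\<bar>x\<bar> powr s \<le> 1 powr s" using assms by (intro powr_mono2) auto
  then show ?thesis by (simp add: add_increasing2)
next
  case False
  then show ?thesis using powr_mono[of s r "\<bar>x\<bar>"] assms by linarith
qed

text \<open>The exponent is bounded by -n (l n^(g-1) - ln K), and g > 1 drives the bracket to
  infinity. Taking |C| + 1 for K makes the logarithm meaningful also for C = 0.\<close>

lemma exp_neg_powr_times_power_tendsto_0:
  fixes C l g :: real
  assumes "0 < l" "1 < g"
  shows "(\<lambda>n. exp (- l * real n powr g) * C ^ n) \<longlonglongrightarrow> 0"
proof -
  define K where "K = \<bar>C\<bar> + 1"
  have K: "K > 0" "\<bar>C\<bar> \<le> K" by (auto simp: K_def)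
  have lim1: "filterlim (\<lambda>n. l * real n powr (g - 1) - ln K) at_top sequentially"
    unfolding diff_conv_add_uminus[of _ "ln K"] add.commute[of _ "- ln K"]
    by (intro filterlim_tendsto_add_at_top[OF tendsto_const] filterlim_tendsto_pos_mult_at_top[OF tendsto_const]
        filterlim_compose[OF real_powr_at_top filterlim_real_sequentially]) (use assms in auto)
  have lim2: "filterlim (\<lambda>n. real n * (l * real n powr (g - 1) - ln K)) at_top sequentially"
    by (rule filterlim_at_top_mult_at_top[OF filterlim_real_sequentially lim1])
  have lim3: "(\<lambda>n. exp (- (real n * (l * real n powr (g - 1) - ln K)))) \<longlonglongrightarrow> 0"
    by (rule filterlim_compose[OF exp_at_bot]) (use lim2 in \<open>simp add: filterlim_uminus_at_bot\<close>)
  show ?thesis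
  proof (rule Lim_null_comparison[OF _ lim3])
    show "\<forall>\<^sub>F n in sequentially. norm (exp (- l * real n powr g) * C ^ n)
        \<le> exp (- (real n * (l * real n powr (g - 1) - ln K)))"
    proof (rule eventually_sequentiallyI[of 1])
      fix n :: nat assume n: "1 \<le> n"
      have "norm (exp (- l * real n powr g) * C ^ n) \<le> exp (- l * real n powr g) * K ^ n"
        using K by (simp add: abs_mult power_abs power_mono)
      also have "K ^ n = exp (real n * ln K)" using K by (simp only: exp_of_nat_mult exp_ln)
      also have "exp (- l * real n powr g) * exp (real n * ln K)
          = exp (- (real n * (l * real n powr (g - 1) - ln K)))"
        unfolding exp_add[symmetric] using powr_add[of "real n" 1 "g - 1"] n
        by (simp add: right_diff_distrib mult.left_commute)
      finally show "norm (exp (- l * real n powr g) * C ^ n)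
        \<le> exp (- (real n * (l * real n powr (g - 1) - ln K)))" .
    qed
  qed
qed

section \<open>Gaussian innovations and weighted square-integrable processes\<close>

text \<open>Every summand is at most the largest one. The resulting factor polynomial in n is crude
  but harmless against the weight.\<close>

lemma power_sum_abs_le:
  fixes f :: "nat \<Rightarrow> real"
  assumes "0 < m"
  shows "(\<Sum>k<n. \<bar>f k\<bar>) ^ (2 * m) \<le> real n ^ (2 * m) * (\<Sum>k<n. f k ^ (2 * m))"
proof (cases "n = 0")
  case False
  have fin: "finite ((\<lambda>k. \<bar>f k\<bar>) ` {..<n})" "(\<lambda>k. \<bar>f k\<bar>) ` {..<n} \<noteq> {}" using False by auto
  obtain j where j: "j < n" "Max ((\<lambda>k. \<bar>f k\<bar>) ` {..<n}) = \<bar>f j\<bar>"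
    using Max_in[OF fin] by auto
  have "\<bar>f k\<bar> \<le> \<bar>f j\<bar>" if "k < n" for k
    using Max_ge[OF fin(1), of "\<bar>f k\<bar>"] that j(2) by auto
  then have "(\<Sum>k<n. \<bar>f k\<bar>) \<le> real n * \<bar>f j\<bar>"
    using sum_bounded_above[of "{..<n}" "\<lambda>k. \<bar>f k\<bar>" "\<bar>f j\<bar>"] by simp
  then have "(\<Sum>k<n. \<bar>f k\<bar>) ^ (2 * m) \<le> (real n * \<bar>f j\<bar>) ^ (2 * m)"
    by (intro power_mono sum_nonneg) auto
  also have "\<dots> = real n ^ (2 * m) * f j ^ (2 * m)"
    by (simp add: power_mult_distrib power_even_abs)
  also have "\<dots> \<le> real n ^ (2 * m) * (\<Sum>k<n. f k ^ (2 * m))"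
    using j(1) by (intro mult_left_mono member_le_sum) (auto simp: zero_le_even_power)
  finally show ?thesis .
qed (use assms in \<open>simp add: power_0_left\<close>)

section \<open>Innovations independent of the past, and processes negligible against the
  weight\<close>

text \<open>Only these properties of the noise enter the moment estimates and the duality step;
  fractional Brownian motion is reduced to them later. \<open>w_power\<close> expresses that the
  weight beats every geometric growth.\<close>

locale gaussian_innovations = prob_space M for M :: "'a measure" +
  fixes F :: "nat \<Rightarrow> 'a measure" and eta :: "nat \<Rightarrow> 'a \<Rightarrow> real" and w :: "nat \<Rightarrow> real"
  assumes subalg: "subalgebra M (F n)"
    and filtration: "subalgebra (F (Suc n)) (F n)"
    and eta_adapted: "eta n \<in> borel_measurable (F (Suc n))"
    and indep_past: "U \<in> borel_measurable (F n) \<Longrightarrow> indep_var borel U borel (eta n)"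
    and eta_normal: "distributed M lborel (eta n) std_normal_density"
    and w_pos: "0 < w n"
    and w_power: "(\<lambda>n. w n * C ^ n) \<longlonglongrightarrow> 0"
begin

lemma measurable_past: "U \<in> borel_measurable (F n) \<Longrightarrow> U \<in> borel_measurable M"
  using measurable_from_subalg[OF subalg] by blast

lemma measurable_filtration: "m \<le> n \<Longrightarrow> U \<in> borel_measurable (F m) \<Longrightarrow> U \<in> borel_measurable (F n)"
  by (induction rule: dec_induct) (auto intro: measurable_from_subalg[OF filtration])

lemma space_F [simp]: "space (F n) = space M"
  using subalg by (simp add: subalgebra_def)

lemma eta_measurable [measurable]: "eta n \<in> borel_measurable M"
  using measurable_past[OF eta_adapted] .

lemma eta_power_integrable: "integrable M (\<lambda>\<omega>. eta n \<omega> ^ m)"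
  using distributed_integrable[OF eta_normal, of "\<lambda>x. x ^ m"] integrable_std_normal_moment
  by simp

lemma eta_even_moment: "(\<integral>\<omega>. eta n \<omega> ^ (2 * m) \<partial>M) = fact (2 * m) / (2 ^ m * fact m)"
  using distributed_integral[OF eta_normal, of "\<lambda>x. x ^ (2 * m)"] integral_std_normal_moment_even[of m]
  by simp

lemma eta_mean: "(\<integral>\<omega>. eta n \<omega> \<partial>M) = 0"
  using distributed_integral[OF eta_normal, of "\<lambda>x. x"] integral_std_normal_moment_odd[of 0]
  by simp

text \<open>Independence factorizes both expectations, and the innovation has mean 0 and second
  moment 1. Integrability of \<open>U\<close> alone suffices, so \<open>U\<close> may be a product
  of two square-integrable factors.\<close>

lemma past_mult_eta:
  assumes U: "U \<in> borel_measurable (F n)" "integrable M U"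
  shows "integrable M (\<lambda>\<omega>. U \<omega> * eta n \<omega>)" "(\<integral>\<omega>. U \<omega> * eta n \<omega> \<partial>M) = 0"
    and "integrable M (\<lambda>\<omega>. U \<omega> * (eta n \<omega>)\<^sup>2)" "(\<integral>\<omega>. U \<omega> * (eta n \<omega>)\<^sup>2 \<partial>M) = (\<integral>\<omega>. U \<omega> \<partial>M)"
proof -
  have i: "indep_var borel U borel (eta n)" by (rule indep_past[OF U(1)])
  have i2: "indep_var borel U borel (\<lambda>\<omega>. (eta n \<omega>)\<^sup>2)"
    using indep_var_compose[OF i, of id borel "\<lambda>x. x\<^sup>2" borel] by (simp add: comp_def)
  have e1: "integrable M (eta n)" using eta_power_integrable[of n 1] by simp
  have e2: "integrable M (\<lambda>\<omega>. (eta n \<omega>)\<^sup>2)" by (rule eta_power_integrable)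
  have m2: "(\<integral>\<omega>. (eta n \<omega>)\<^sup>2 \<partial>M) = 1" using eta_even_moment[of n 1] by simp
  show "integrable M (\<lambda>\<omega>. U \<omega> * eta n \<omega>)" "(\<integral>\<omega>. U \<omega> * eta n \<omega> \<partial>M) = 0"
    using indep_var_integrable[OF i U(2) e1] indep_var_lebesgue_integral[OF i U(2) e1] eta_mean
    by simp_all
  show "integrable M (\<lambda>\<omega>. U \<omega> * (eta n \<omega>)\<^sup>2)" "(\<integral>\<omega>. U \<omega> * (eta n \<omega>)\<^sup>2 \<partial>M) = (\<integral>\<omega>. U \<omega> \<partial>M)"
    using indep_var_integrable[OF i2 U(2) e2] indep_var_lebesgue_integral[OF i2 U(2) e2] m2
    by simp_all
qed

text \<open>All the boundary terms of the duality argument vanish because they are products of two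
  processes from this class.\<close>

definition square_negligible :: "(nat \<Rightarrow> 'a \<Rightarrow> real) set" where
  "square_negligible = {V. (\<forall>n. V n \<in> borel_measurable (F n) \<and> integrable M (\<lambda>\<omega>. (V n \<omega>)\<^sup>2)) \<and>
     (\<lambda>n. w n * (\<integral>\<omega>. (V n \<omega>)\<^sup>2 \<partial>M)) \<longlonglongrightarrow> 0}"

lemma square_negligibleD:
  assumes "V \<in> square_negligible"
  shows "V n \<in> borel_measurable (F n)" "V n \<in> borel_measurable M" "integrable M (\<lambda>\<omega>. (V n \<omega>)\<^sup>2)"
    "(\<lambda>n. w n * (\<integral>\<omega>. (V n \<omega>)\<^sup>2 \<partial>M)) \<longlonglongrightarrow> 0"
  using assms measurable_past unfolding square_negligible_def by blast+

lemma negligible_dominated: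
  assumes V: "\<And>n. V n \<in> borel_measurable M"
    and B: "\<And>n. integrable M (B n)" "(\<lambda>n. w n * (\<integral>\<omega>. B n \<omega> \<partial>M)) \<longlonglongrightarrow> 0"
    and le: "\<And>n. AE \<omega> in M. \<bar>V n \<omega>\<bar> \<le> B n \<omega>"
  shows "integrable M (V n)" "(\<lambda>n. w n * (\<integral>\<omega>. V n \<omega> \<partial>M)) \<longlonglongrightarrow> 0"
proof -
  have i: "integrable M (V n)" for n
    by (rule Bochner_Integration.integrable_bound[OF B(1)[of n] V]) (use le[of n] in \<open>eventually_elim, auto\<close>)
  then show "integrable M (V n)" .
  have "\<bar>\<integral>\<omega>. V n \<omega> \<partial>M\<bar> \<le> (\<integral>\<omega>. B n \<omega> \<partial>M)" for n
  proof -
    have "\<bar>\<integral>\<omega>. V n \<omega> \<partial>M\<bar> \<le> (\<integral>\<omega>. \<bar>V n \<omega>\<bar> \<partial>M)" by (rule integral_abs_bound)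
    also have "\<dots> \<le> (\<integral>\<omega>. B n \<omega> \<partial>M)"
      by (rule integral_mono_AE[OF integrable_abs[OF i] B(1) le])
    finally show ?thesis .
  qed
  then show "(\<lambda>n. w n * (\<integral>\<omega>. V n \<omega> \<partial>M)) \<longlonglongrightarrow> 0"
    using w_pos by (intro Lim_null_comparison[OF _ B(2)]) (auto simp: abs_mult less_imp_le)
qed

text \<open>From (s + t)^2 \<le> 2 s^2 + 2 t^2. The two-term bound is the shape of a Lipschitz
  estimate, so sums, differences and coefficient increments are all instances.\<close>

lemma square_negligible_dominated:
  assumes V: "\<And>n. V n \<in> borel_measurable (F n)"
    and W: "W \<in> square_negligible" "W' \<in> square_negligible"
    and le: "\<And>n \<omega>. \<omega> \<in> space M \<Longrightarrow> \<bar>V n \<omega>\<bar> \<le> C * (\<bar>W n \<omega>\<bar> + \<bar>W' n \<omega>\<bar>)"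
  shows "V \<in> square_negligible"
proof -
  note D = square_negligibleD[OF W(1)] square_negligibleD[OF W(2)]
  let ?B = "\<lambda>n \<omega>. 2 * C\<^sup>2 * (W n \<omega>)\<^sup>2 + 2 * C\<^sup>2 * (W' n \<omega>)\<^sup>2"
  have B: "integrable M (?B n)" for n using D by auto
  have "(\<lambda>n. 2 * C\<^sup>2 * (w n * (\<integral>\<omega>. (W n \<omega>)\<^sup>2 \<partial>M)) + 2 * C\<^sup>2 * (w n * (\<integral>\<omega>. (W' n \<omega>)\<^sup>2 \<partial>M)))
      \<longlonglongrightarrow> 2 * C\<^sup>2 * 0 + 2 * C\<^sup>2 * 0"
    by (intro tendsto_intros D)
  moreover have "w n * (\<integral>\<omega>. ?B n \<omega> \<partial>M)
      = 2 * C\<^sup>2 * (w n * (\<integral>\<omega>. (W n \<omega>)\<^sup>2 \<partial>M)) + 2 * C\<^sup>2 * (w n * (\<integral>\<omega>. (W' n \<omega>)\<^sup>2 \<partial>M))" for n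
    using D by (simp add: algebra_simps)
  ultimately have lim: "(\<lambda>n. w n * (\<integral>\<omega>. ?B n \<omega> \<partial>M)) \<longlonglongrightarrow> 0" by simp
  have le2: "AE \<omega> in M. \<bar>(V n \<omega>)\<^sup>2\<bar> \<le> ?B n \<omega>" for n
  proof (rule AE_I2)
    fix \<omega> assume "\<omega> \<in> space M"
    then have "\<bar>V n \<omega>\<bar>\<^sup>2 \<le> (C * (\<bar>W n \<omega>\<bar> + \<bar>W' n \<omega>\<bar>))\<^sup>2" by (intro power_mono le) auto
    also have "\<dots> \<le> ?B n \<omega>"
    proof -
      have "(\<bar>W n \<omega>\<bar> + \<bar>W' n \<omega>\<bar>)\<^sup>2 \<le> 2 * (W n \<omega>)\<^sup>2 + 2 * (W' n \<omega>)\<^sup>2"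
        using sum_squares_bound[of "\<bar>W n \<omega>\<bar>" "\<bar>W' n \<omega>\<bar>"] by (simp add: power2_sum)
      then have "C\<^sup>2 * (\<bar>W n \<omega>\<bar> + \<bar>W' n \<omega>\<bar>)\<^sup>2 \<le> C\<^sup>2 * (2 * (W n \<omega>)\<^sup>2 + 2 * (W' n \<omega>)\<^sup>2)"
        by (intro mult_left_mono) auto
      then show ?thesis unfolding power_mult_distrib by (simp add: algebra_simps)
    qed
    finally show "\<bar>(V n \<omega>)\<^sup>2\<bar> \<le> ?B n \<omega>" by simp
  qed
  have meas: "(\<lambda>\<omega>. (V n \<omega>)\<^sup>2) \<in> borel_measurable M" for n
    using measurable_past[OF V[of n]] by measurable
  show ?thesis
    unfolding square_negligible_def
    using V negligible_dominated[OF meas B lim le2] by auto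
qed

lemma square_negligible_add:
  assumes "V \<in> square_negligible" "W \<in> square_negligible"
  shows "(\<lambda>n \<omega>. V n \<omega> + W n \<omega>) \<in> square_negligible"
  by (rule square_negligible_dominated[OF _ assms, of _ 1])
    (use square_negligibleD(1)[OF assms(1)] square_negligibleD(1)[OF assms(2)] in auto)

lemma square_negligible_diff:
  assumes "V \<in> square_negligible" "W \<in> square_negligible"
  shows "(\<lambda>n \<omega>. V n \<omega> - W n \<omega>) \<in> square_negligible"
  by (rule square_negligible_dominated[OF _ assms, of _ 1])
    (use square_negligibleD(1)[OF assms(1)] square_negligibleD(1)[OF assms(2)] in auto)

lemma square_negligible_abs:
  assumes "V \<in> square_negligible"
  shows "(\<lambda>n \<omega>. \<bar>V n \<omega>\<bar>) \<in> square_negligible"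
  by (rule square_negligible_dominated[OF _ assms assms, of _ 1])
    (use square_negligibleD(1)[OF assms] in auto)

lemma square_negligible_mult_bounded:
  assumes "V \<in> square_negligible"
    and "\<And>n. a n \<in> borel_measurable (F n)" "\<And>n \<omega>. \<omega> \<in> space M \<Longrightarrow> \<bar>a n \<omega>\<bar> \<le> L"
  shows "(\<lambda>n \<omega>. a n \<omega> * V n \<omega>) \<in> square_negligible"
proof (rule square_negligible_dominated[OF _ assms(1) assms(1), of _ L])
  show "(\<lambda>\<omega>. a n \<omega> * V n \<omega>) \<in> borel_measurable (F n)" for n
    using square_negligibleD(1)[OF assms(1), of n] assms(2)[of n] by measurable
  fix n \<omega> assume \<omega>: "\<omega> \<in> space M"
  have "\<bar>a n \<omega>\<bar> * \<bar>V n \<omega>\<bar> \<le> L * \<bar>V n \<omega>\<bar>" using assms(3)[OF \<omega>] by (intro mult_right_mono) auto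
  moreover have "0 \<le> L * \<bar>V n \<omega>\<bar>" using assms(3)[OF \<omega>, of n] by (intro mult_nonneg_nonneg) auto
  ultimately show "\<bar>a n \<omega> * V n \<omega>\<bar> \<le> L * (\<bar>V n \<omega>\<bar> + \<bar>V n \<omega>\<bar>)"
    by (simp add: abs_mult algebra_simps)
qed

text \<open>This class is meant for integrands of boundary terms: they are products of two
  processes, signed, and closed under sums once expanded.\<close>

definition negligible :: "(nat \<Rightarrow> 'a \<Rightarrow> real) set" where
  "negligible = {Q. (\<forall>n. integrable M (Q n)) \<and> (\<lambda>n. w n * (\<integral>\<omega>. Q n \<omega> \<partial>M)) \<longlonglongrightarrow> 0}"

lemma negligibleD:
  assumes "Q \<in> negligible"
  shows "integrable M (Q n)" "(\<lambda>n. w n * (\<integral>\<omega>. Q n \<omega> \<partial>M)) \<longlonglongrightarrow> 0"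
  using assms by (auto simp: negligible_def)

lemma negligible_add:
  assumes "P \<in> negligible" "Q \<in> negligible"
  shows "(\<lambda>n \<omega>. P n \<omega> + Q n \<omega>) \<in> negligible"
proof -
  note D = negligibleD[OF assms(1)] negligibleD[OF assms(2)]
  show ?thesis
    using D(1,3) tendsto_add[OF D(2,4)] by (simp add: negligible_def distrib_left)
qed

lemma negligible_diff:
  assumes "P \<in> negligible" "Q \<in> negligible"
  shows "(\<lambda>n \<omega>. P n \<omega> - Q n \<omega>) \<in> negligible"
proof -
  note D = negligibleD[OF assms(1)] negligibleD[OF assms(2)]
  show ?thesis
    using D(1,3) tendsto_diff[OF D(2,4)] by (simp add: negligible_def right_diff_distrib)
qed

lemma square_negligible_mult:
  assumes "V \<in> square_negligible" "W \<in> square_negligible"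
  shows "(\<lambda>n \<omega>. V n \<omega> * W n \<omega>) \<in> negligible"
proof -
  note D = square_negligibleD[OF assms(1)] square_negligibleD[OF assms(2)]
  let ?B = "\<lambda>n \<omega>. (V n \<omega>)\<^sup>2 + (W n \<omega>)\<^sup>2"
  have B: "integrable M (?B n)" for n using D by auto
  have "(\<lambda>n. w n * (\<integral>\<omega>. (V n \<omega>)\<^sup>2 \<partial>M) + w n * (\<integral>\<omega>. (W n \<omega>)\<^sup>2 \<partial>M)) \<longlonglongrightarrow> 0 + 0"
    by (intro tendsto_add D)
  then have lim: "(\<lambda>n. w n * (\<integral>\<omega>. ?B n \<omega> \<partial>M)) \<longlonglongrightarrow> 0"
    using D by (simp add: distrib_left)
  have le: "AE \<omega> in M. \<bar>V n \<omega> * W n \<omega>\<bar> \<le> ?B n \<omega>" for n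
  proof (rule AE_I2)
    fix \<omega>
    have "0 \<le> \<bar>V n \<omega>\<bar> * \<bar>W n \<omega>\<bar>" by simp
    then show "\<bar>V n \<omega> * W n \<omega>\<bar> \<le> ?B n \<omega>"
      using sum_squares_bound[of "\<bar>V n \<omega>\<bar>" "\<bar>W n \<omega>\<bar>"] unfolding abs_mult power2_abs by linarith
  qed
  have meas: "(\<lambda>\<omega>. V n \<omega> * W n \<omega>) \<in> borel_measurable M" for n
    using D(2)[of n] D(6)[of n] by measurable
  show ?thesis
    unfolding negligible_def using negligible_dominated[OF meas B lim le] by auto
qed

section \<open>Pairing of forward and backward equations\<close>

text \<open>Multiplying the two equations gives w n (A + B \<eta>)(C + D \<eta>). In expectation the
  terms linear in the innovation vanish and its square contributes 1, leaving A C + B D. The pair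
  (A, B) will be (\<open>p\<close>, \<open>q\<close>) or (\<open>dY\<close>,
  \<open>dZ\<close>).\<close>

lemma duality_step:
  assumes A: "A \<in> borel_measurable (F n)" "B \<in> borel_measurable (F n)"
      "C \<in> borel_measurable (F n)" "D \<in> borel_measurable (F n)"
    and int: "integrable M (\<lambda>\<omega>. A \<omega> * C \<omega>)" "integrable M (\<lambda>\<omega>. A \<omega> * D \<omega>)"
      "integrable M (\<lambda>\<omega>. B \<omega> * C \<omega>)" "integrable M (\<lambda>\<omega>. B \<omega> * D \<omega>)"
    and bwd: "AE \<omega> in M. w n * (A \<omega> + B \<omega> * eta n \<omega>) = w (Suc n) * R \<omega>"
    and fwd: "AE \<omega> in M. V \<omega> = C \<omega> + D \<omega> * eta n \<omega>"
    and VR: "(\<lambda>\<omega>. V \<omega> * R \<omega>) \<in> borel_measurable M"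
  shows "w (Suc n) * (\<integral>\<omega>. V \<omega> * R \<omega> \<partial>M) = w n * (\<integral>\<omega>. A \<omega> * C \<omega> + B \<omega> * D \<omega> \<partial>M)"
proof -
  note [measurable] = A[THEN measurable_past]
  have m: "(\<lambda>\<omega>. A \<omega> * D \<omega>) \<in> borel_measurable (F n)" "(\<lambda>\<omega>. B \<omega> * C \<omega>) \<in> borel_measurable (F n)"
    "(\<lambda>\<omega>. B \<omega> * D \<omega>) \<in> borel_measurable (F n)"
    using A by measurable
  note p = past_mult_eta[OF m(1) int(2)] past_mult_eta[OF m(2) int(3)] past_mult_eta[OF m(3) int(4)]
  have "w (Suc n) * (\<integral>\<omega>. V \<omega> * R \<omega> \<partial>M) = (\<integral>\<omega>. w (Suc n) * (V \<omega> * R \<omega>) \<partial>M)" by simp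
  also have "\<dots> = (\<integral>\<omega>. w n * (A \<omega> * C \<omega> + A \<omega> * D \<omega> * eta n \<omega> + B \<omega> * C \<omega> * eta n \<omega>
        + B \<omega> * D \<omega> * (eta n \<omega>)\<^sup>2) \<partial>M)"
  proof (rule integral_cong_AE)
    show "AE \<omega> in M. w (Suc n) * (V \<omega> * R \<omega>) = w n * (A \<omega> * C \<omega> + A \<omega> * D \<omega> * eta n \<omega> + B \<omega> * C \<omega> * eta n \<omega>
        + B \<omega> * D \<omega> * (eta n \<omega>)\<^sup>2)"
      using bwd fwd
    proof eventually_elim
      case (elim \<omega>)
      have "w (Suc n) * (V \<omega> * R \<omega>) = V \<omega> * (w (Suc n) * R \<omega>)" by simp
      also have "\<dots> = (C \<omega> + D \<omega> * eta n \<omega>) * (w n * (A \<omega> + B \<omega> * eta n \<omega>))" using elim by simp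
      finally show ?case by (simp add: algebra_simps power2_eq_square)
    qed
  qed (use VR in measurable)
  also have "\<dots> = w n * ((\<integral>\<omega>. A \<omega> * C \<omega> \<partial>M) + (\<integral>\<omega>. B \<omega> * D \<omega> \<partial>M))"
    using p int by simp
  also have "(\<integral>\<omega>. A \<omega> * C \<omega> \<partial>M) + (\<integral>\<omega>. B \<omega> * D \<omega> \<partial>M) = (\<integral>\<omega>. A \<omega> * C \<omega> + B \<omega> * D \<omega> \<partial>M)"
    using int by simp
  finally show ?thesis .
qed

text \<open>The cross term averages out, so each step multiplies the second moment by at most 2 L^2;
  growth is geometric and loses to the weight. Times 0 and 1 are separate data because the recursion
  is only assumed from time 1.\<close>

lemma linear_recursion_square_negligible:
  assumes init: "V 0 \<in> borel_measurable (F 0)" "integrable M (\<lambda>\<omega>. (V 0 \<omega>)\<^sup>2)"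
      "V 1 \<in> borel_measurable (F 1)" "integrable M (\<lambda>\<omega>. (V 1 \<omega>)\<^sup>2)"
    and rec: "\<And>n \<omega>. 1 \<le> n \<Longrightarrow> \<omega> \<in> space M \<Longrightarrow> V (Suc n) \<omega> = a n \<omega> * V n \<omega> + b n \<omega> * V n \<omega> * eta n \<omega>"
    and a: "\<And>n. a n \<in> borel_measurable (F n)" "\<And>n \<omega>. \<omega> \<in> space M \<Longrightarrow> \<bar>a n \<omega>\<bar> \<le> L"
    and b: "\<And>n. b n \<in> borel_measurable (F n)" "\<And>n \<omega>. \<omega> \<in> space M \<Longrightarrow> \<bar>b n \<omega>\<bar> \<le> L"
  shows "V \<in> square_negligible"
proof -
  let ?E = "\<lambda>n. \<integral>\<omega>. (V n \<omega>)\<^sup>2 \<partial>M"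
  have step: "V (Suc n) \<in> borel_measurable (F (Suc n)) \<and> integrable M (\<lambda>\<omega>. (V (Suc n) \<omega>)\<^sup>2) \<and>
      ?E (Suc n) \<le> 2 * L\<^sup>2 * ?E n"
    if n: "1 \<le> n" and V: "V n \<in> borel_measurable (F n)" "integrable M (\<lambda>\<omega>. (V n \<omega>)\<^sup>2)" for n
  proof -
    note m = measurable_filtration[OF le_SucI[OF order_refl]]
    have meas: "(\<lambda>\<omega>. a n \<omega> * V n \<omega> + b n \<omega> * V n \<omega> * eta n \<omega>) \<in> borel_measurable (F (Suc n))"
      by (intro borel_measurable_add borel_measurable_times m[OF V(1)] m[OF a(1)] m[OF b(1)] eta_adapted)
    have 1: "V (Suc n) \<in> borel_measurable (F (Suc n))"
      by (subst measurable_cong[OF rec[OF n]]) (use meas in auto)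
    \<comment> \<open>The two-sided form serves both the integrability of the three products and the
      upper bounds on the two that survive integration.\<close>
    have bd: "(c \<omega> * d \<omega>) * (V n \<omega>)\<^sup>2 \<in> {- (L\<^sup>2 * (V n \<omega>)\<^sup>2) .. L\<^sup>2 * (V n \<omega>)\<^sup>2}"
      if "\<bar>c \<omega>\<bar> \<le> L" "\<bar>d \<omega>\<bar> \<le> L" for c d :: "'a \<Rightarrow> real" and \<omega>
    proof -
      have "\<bar>c \<omega> * d \<omega>\<bar> \<le> L\<^sup>2" unfolding abs_mult power2_eq_square using that by (intro mult_mono) auto
      then have "\<bar>c \<omega> * d \<omega>\<bar> * (V n \<omega>)\<^sup>2 \<le> L\<^sup>2 * (V n \<omega>)\<^sup>2" by (intro mult_right_mono) auto
      then have "\<bar>(c \<omega> * d \<omega>) * (V n \<omega>)\<^sup>2\<bar> \<le> L\<^sup>2 * (V n \<omega>)\<^sup>2" by (simp add: abs_mult)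
      then show ?thesis by auto
    qed
    have int: "integrable M (\<lambda>\<omega>. (c \<omega> * d \<omega>) * (V n \<omega>)\<^sup>2)"
      if cd: "c \<in> borel_measurable (F n)" "d \<in> borel_measurable (F n)"
        "\<And>\<omega>. \<omega> \<in> space M \<Longrightarrow> \<bar>c \<omega>\<bar> \<le> L" "\<And>\<omega>. \<omega> \<in> space M \<Longrightarrow> \<bar>d \<omega>\<bar> \<le> L" for c d
    proof (rule Bochner_Integration.integrable_bound)
      show "integrable M (\<lambda>\<omega>. L\<^sup>2 * (V n \<omega>)\<^sup>2)" using V(2) by simp
      show "(\<lambda>\<omega>. c \<omega> * d \<omega> * (V n \<omega>)\<^sup>2) \<in> borel_measurable M"
        using measurable_past[OF cd(1)] measurable_past[OF cd(2)] measurable_past[OF V(1)] by measurable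
      show "AE \<omega> in M. norm (c \<omega> * d \<omega> * (V n \<omega>)\<^sup>2) \<le> norm (L\<^sup>2 * (V n \<omega>)\<^sup>2)"
      proof (rule AE_I2)
        fix \<omega> assume "\<omega> \<in> space M"
        then show "norm (c \<omega> * d \<omega> * (V n \<omega>)\<^sup>2) \<le> norm (L\<^sup>2 * (V n \<omega>)\<^sup>2)"
          using bd[of c \<omega> d] cd(3,4) by (auto simp: abs_le_iff)
      qed
    qed
    have iaa: "integrable M (\<lambda>\<omega>. (a n \<omega> * a n \<omega>) * (V n \<omega>)\<^sup>2)" by (intro int a b)
    have iab: "integrable M (\<lambda>\<omega>. (a n \<omega> * b n \<omega>) * (V n \<omega>)\<^sup>2)" by (intro int a b)
    have ibb: "integrable M (\<lambda>\<omega>. (b n \<omega> * b n \<omega>) * (V n \<omega>)\<^sup>2)" by (intro int a b)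
    have mab: "(\<lambda>\<omega>. (a n \<omega> * b n \<omega>) * (V n \<omega>)\<^sup>2) \<in> borel_measurable (F n)"
      "(\<lambda>\<omega>. (b n \<omega> * b n \<omega>) * (V n \<omega>)\<^sup>2) \<in> borel_measurable (F n)"
      using a(1)[of n] b(1)[of n] V(1) by measurable
    note p = past_mult_eta[OF mab(1) iab] past_mult_eta[OF mab(2) ibb]
    let ?S = "\<lambda>\<omega>. (a n \<omega> * a n \<omega>) * (V n \<omega>)\<^sup>2 + 2 * ((a n \<omega> * b n \<omega>) * (V n \<omega>)\<^sup>2 * eta n \<omega>)
        + (b n \<omega> * b n \<omega>) * (V n \<omega>)\<^sup>2 * (eta n \<omega>)\<^sup>2"
    have eq: "(V (Suc n) \<omega>)\<^sup>2 = ?S \<omega>" if "\<omega> \<in> space M" for \<omega>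
      unfolding rec[OF n that] by (simp add: power2_eq_square algebra_simps)
    have iS: "integrable M ?S" using p iaa by auto
    have 2: "integrable M (\<lambda>\<omega>. (V (Suc n) \<omega>)\<^sup>2)"
      using iS by (subst Bochner_Integration.integrable_cong[OF refl eq])
    have "?E (Suc n) = (\<integral>\<omega>. ?S \<omega> \<partial>M)"
      by (rule Bochner_Integration.integral_cong[OF refl eq])
    also have "\<dots> = (\<integral>\<omega>. (a n \<omega> * a n \<omega>) * (V n \<omega>)\<^sup>2 \<partial>M) + (\<integral>\<omega>. (b n \<omega> * b n \<omega>) * (V n \<omega>)\<^sup>2 \<partial>M)"
      using p iaa by simp
    also have "\<dots> \<le> (\<integral>\<omega>. L\<^sup>2 * (V n \<omega>)\<^sup>2 \<partial>M) + (\<integral>\<omega>. L\<^sup>2 * (V n \<omega>)\<^sup>2 \<partial>M)"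
    proof (intro add_mono integral_mono)
      show "a n \<omega> * a n \<omega> * (V n \<omega>)\<^sup>2 \<le> L\<^sup>2 * (V n \<omega>)\<^sup>2" if "\<omega> \<in> space M" for \<omega>
        using bd[of "a n" \<omega> "a n"] a(2)[OF that] by auto
      show "b n \<omega> * b n \<omega> * (V n \<omega>)\<^sup>2 \<le> L\<^sup>2 * (V n \<omega>)\<^sup>2" if "\<omega> \<in> space M" for \<omega>
        using bd[of "b n" \<omega> "b n"] b(2)[OF that] by auto
    qed (use iaa ibb V(2) in auto)
    also have "\<dots> = 2 * L\<^sup>2 * ?E n" by simp
    finally show ?thesis using 1 2 by simp
  qed
  have main: "V (Suc n) \<in> borel_measurable (F (Suc n)) \<and> integrable M (\<lambda>\<omega>. (V (Suc n) \<omega>)\<^sup>2) \<and>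
      ?E (Suc n) \<le> (2 * L\<^sup>2) ^ n * ?E 1" for n
  proof (induction n)
    case 0
    then show ?case using init by simp
  next
    case (Suc n)
    have "?E (Suc (Suc n)) \<le> 2 * L\<^sup>2 * ?E (Suc n)" using step[of "Suc n"] Suc by auto
    also have "\<dots> \<le> 2 * L\<^sup>2 * ((2 * L\<^sup>2) ^ n * ?E 1)" using Suc by (intro mult_left_mono) auto
    finally show ?case using step[of "Suc n"] Suc by (simp add: mult.assoc)
  qed
  have lim: "(\<lambda>n. w (Suc n) * ?E (Suc n)) \<longlonglongrightarrow> 0"
  proof (rule Lim_null_comparison)
    \<comment> \<open>Adding 1 to the growth rate makes the base at least 1, so its powers increase
      and the shift from n to \<open>Suc n\<close> is absorbed.\<close>
    have "(\<lambda>n. w (Suc n) * (2 * L\<^sup>2 + 1) ^ Suc n) \<longlonglongrightarrow> 0" using w_power LIMSEQ_Suc by blast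
    then show "(\<lambda>n. ?E 1 * (w (Suc n) * (2 * L\<^sup>2 + 1) ^ Suc n)) \<longlonglongrightarrow> 0"
      by (rule tendsto_mult_right_zero)
    show "\<forall>\<^sub>F n in sequentially. norm (w (Suc n) * ?E (Suc n)) \<le> ?E 1 * (w (Suc n) * (2 * L\<^sup>2 + 1) ^ Suc n)"
    proof (intro always_eventually allI)
      fix n
      have "(2 * L\<^sup>2) ^ n \<le> (2 * L\<^sup>2 + 1) ^ n" by (intro power_mono) auto
      also have "\<dots> \<le> (2 * L\<^sup>2 + 1) ^ Suc n" by (intro power_increasing) auto
      finally have "(2 * L\<^sup>2) ^ n * ?E 1 \<le> (2 * L\<^sup>2 + 1) ^ Suc n * ?E 1" by (intro mult_right_mono) auto
      then have "?E (Suc n) \<le> (2 * L\<^sup>2 + 1) ^ Suc n * ?E 1" using main[of n] by linarith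
      then have "w (Suc n) * ?E (Suc n) \<le> w (Suc n) * ((2 * L\<^sup>2 + 1) ^ Suc n * ?E 1)"
        using w_pos[of "Suc n"] by (intro mult_left_mono) auto
      moreover have "0 \<le> w (Suc n) * ?E (Suc n)" using w_pos[of "Suc n"] by auto
      ultimately show "norm (w (Suc n) * ?E (Suc n)) \<le> ?E 1 * (w (Suc n) * (2 * L\<^sup>2 + 1) ^ Suc n)"
        by (simp only: real_norm_def abs_of_nonneg mult.commute mult.left_commute)
    qed
  qed
  have "V n \<in> borel_measurable (F n) \<and> integrable M (\<lambda>\<omega>. (V n \<omega>)\<^sup>2)" for n
    using main init by (cases n) auto
  then show ?thesis
    unfolding square_negligible_def
    using LIMSEQ_imp_Suc[where f = "\<lambda>n. w n * ?E n", OF lim] by simp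
qed

section \<open>Moments of linear combinations of innovations\<close>

lemma innovation_sum_adapted: "(\<lambda>\<omega>. \<Sum>k<n. B k * eta k \<omega>) \<in> borel_measurable (F n)"
proof (intro borel_measurable_sum borel_measurable_times)
  show "eta k \<in> borel_measurable (F n)" if "k \<in> {..<n}" for k
    using measurable_filtration[OF _ eta_adapted, of k n] that by auto
qed auto

text \<open>With bounded coefficients the 2m-th moment is at most polynomial in n. Independence of
  the summands is not invoked here: the crude power-sum bound is enough.\<close>

lemma innovation_sum_moments:
  assumes B: "\<And>n k. \<bar>B n k\<bar> \<le> K" and m: "0 < m"
  shows "integrable M (\<lambda>\<omega>. (\<Sum>k<n. B n k * eta k \<omega>) ^ (2 * m))"
    and "(\<lambda>n. w n * (\<integral>\<omega>. (\<Sum>k<n. B n k * eta k \<omega>) ^ (2 * m) \<partial>M)) \<longlonglongrightarrow> 0"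
proof -
  have K: "0 \<le> K" using B[of 0 0] by linarith
  let ?D = "\<lambda>n \<omega>. (K * real n) ^ (2 * m) * (\<Sum>k<n. eta k \<omega> ^ (2 * m))"
  \<comment> \<open>This is the standard normal moment of order 2m.\<close>
  define c :: real where "c = fact (2 * m) / (2 ^ m * fact m)"
  have c: "0 \<le> c" by (simp add: c_def)
  have D: "integrable M (?D n)" for n by (auto intro: eta_power_integrable)
  have ED: "(\<integral>\<omega>. ?D n \<omega> \<partial>M) = (K * real n) ^ (2 * m) * (real n * c)" for n
    using eta_power_integrable by (simp add: eta_even_moment c_def)
  have lim: "(\<lambda>n. w n * (\<integral>\<omega>. ?D n \<omega> \<partial>M)) \<longlonglongrightarrow> 0"
  proof (rule Lim_null_comparison)
    show "(\<lambda>n. K ^ (2 * m) * c * (w n * (2 ^ Suc (2 * m)) ^ n)) \<longlonglongrightarrow> 0"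
      by (rule tendsto_mult_right_zero[OF w_power])
    show "\<forall>\<^sub>F n in sequentially. norm (w n * (\<integral>\<omega>. ?D n \<omega> \<partial>M)) \<le> K ^ (2 * m) * c * (w n * (2 ^ Suc (2 * m)) ^ n)"
    proof (intro always_eventually allI)
      fix n
      \<comment> \<open>Since n < 2^n, the polynomial is replaced by a geometric sequence, the form
        covered by \<open>w_power\<close>.\<close>
      have "real n ^ Suc (2 * m) \<le> (2 ^ n) ^ Suc (2 * m)"
        using of_nat_less_two_power[of n, where 'a = real] by (intro power_mono) auto
      also have "\<dots> = (2 ^ Suc (2 * m)) ^ n" by (simp only: power_mult[symmetric] mult.commute)
      finally have "(K ^ (2 * m) * c * w n) * real n ^ Suc (2 * m) \<le> (K ^ (2 * m) * c * w n) * (2 ^ Suc (2 * m)) ^ n"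
        using K c w_pos[of n] by (intro mult_left_mono) auto
      moreover have "norm (w n * (\<integral>\<omega>. ?D n \<omega> \<partial>M)) = (K ^ (2 * m) * c * w n) * real n ^ Suc (2 * m)"
        unfolding ED using K c w_pos[of n] by (simp add: power_mult_distrib abs_mult)
      ultimately show "norm (w n * (\<integral>\<omega>. ?D n \<omega> \<partial>M)) \<le> K ^ (2 * m) * c * (w n * (2 ^ Suc (2 * m)) ^ n)"
        by (simp only: mult.assoc)
    qed
  qed
  have le: "AE \<omega> in M. \<bar>(\<Sum>k<n. B n k * eta k \<omega>) ^ (2 * m)\<bar> \<le> ?D n \<omega>" for n
  proof (rule AE_I2)
    fix \<omega>
    have "\<bar>\<Sum>k<n. B n k * eta k \<omega>\<bar> \<le> (\<Sum>k<n. \<bar>B n k * eta k \<omega>\<bar>)" by (rule sum_abs)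
    also have "\<dots> \<le> (\<Sum>k<n. K * \<bar>eta k \<omega>\<bar>)" unfolding abs_mult using B by (intro sum_mono mult_right_mono) auto
    finally have "\<bar>\<Sum>k<n. B n k * eta k \<omega>\<bar> ^ (2 * m) \<le> (K * (\<Sum>k<n. \<bar>eta k \<omega>\<bar>)) ^ (2 * m)"
      by (intro power_mono) (auto simp: sum_distrib_left)
    also have "\<dots> \<le> K ^ (2 * m) * (real n ^ (2 * m) * (\<Sum>k<n. eta k \<omega> ^ (2 * m)))"
      unfolding power_mult_distrib using K m by (intro mult_left_mono power_sum_abs_le) auto
    finally show "\<bar>(\<Sum>k<n. B n k * eta k \<omega>) ^ (2 * m)\<bar> \<le> ?D n \<omega>"
      by (simp only: power_abs power_mult_distrib mult.assoc)
  qed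
  have meas: "(\<lambda>\<omega>. (\<Sum>k<n. B n k * eta k \<omega>) ^ (2 * m)) \<in> borel_measurable M" for n by measurable
  show "integrable M (\<lambda>\<omega>. (\<Sum>k<n. B n k * eta k \<omega>) ^ (2 * m))"
    "(\<lambda>n. w n * (\<integral>\<omega>. (\<Sum>k<n. B n k * eta k \<omega>) ^ (2 * m) \<partial>M)) \<longlonglongrightarrow> 0"
    using negligible_dominated[OF meas D lim le] by auto
qed

lemma square_negligible_of_powr:
  assumes V: "\<And>n. V n \<in> borel_measurable (F n)"
    and r: "\<And>n. 2 \<le> r n" "\<And>n. integrable M (\<lambda>\<omega>. \<bar>V n \<omega>\<bar> powr r n)"
      "(\<lambda>n. w n * (\<integral>\<omega>. \<bar>V n \<omega>\<bar> powr r n \<partial>M)) \<longlonglongrightarrow> 0"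
  shows "V \<in> square_negligible"
proof -
  have w0: "w \<longlonglongrightarrow> 0" using w_power[of 1] by simp
  have lim: "(\<lambda>n. w n * (\<integral>\<omega>. 1 + \<bar>V n \<omega>\<bar> powr r n \<partial>M)) \<longlonglongrightarrow> 0"
    using tendsto_add[OF w0 r(3)] r(2) by (simp add: prob_space distrib_left)
  have le: "AE \<omega> in M. \<bar>(V n \<omega>)\<^sup>2\<bar> \<le> 1 + \<bar>V n \<omega>\<bar> powr r n" for n
    using powr_le_one_plus_powr[of 2 "r n"] r(1)[of n] by (intro AE_I2) simp
  have meas: "(\<lambda>\<omega>. (V n \<omega>)\<^sup>2) \<in> borel_measurable M" for n
    using measurable_past[OF V[of n]] by measurable
  have int: "integrable M (\<lambda>\<omega>. 1 + \<bar>V n \<omega>\<bar> powr r n)" for n using r(2) by simp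
  show ?thesis
    unfolding square_negligible_def
    using V negligible_dominated[OF meas int lim le] by auto
qed

text \<open>The lower bound \<open>r0\<close> on the exponents is fixed strictly above 2, so one
  \<open>m\<close> works for all times and the Gaussian factor costs a single even moment.\<close>

lemma square_negligible_mult_innovation_sum:
  assumes V: "\<And>n. V n \<in> borel_measurable (F n)"
    and r0: "2 < r0"
    and r: "\<And>n. r0 \<le> r n" "\<And>n. integrable M (\<lambda>\<omega>. \<bar>V n \<omega>\<bar> powr r n)"
      "(\<lambda>n. w n * (\<integral>\<omega>. \<bar>V n \<omega>\<bar> powr r n \<partial>M)) \<longlonglongrightarrow> 0"
    and B: "\<And>n k. \<bar>B n k\<bar> \<le> K"
  shows "(\<lambda>n \<omega>. V n \<omega> * (\<Sum>k<n. B n k * eta k \<omega>)) \<in> square_negligible"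
proof -
  let ?c = "\<lambda>n \<omega>. \<Sum>k<n. B n k * eta k \<omega>"
  obtain m where m0: "0 < m" and m: "\<And>x c :: real. (x * c)\<^sup>2 \<le> 1 + \<bar>x\<bar> powr r0 + c ^ (2 * m)"
    using square_mult_le_powr_plus_power[OF r0] by blast
  \<comment> \<open>The constant 2 collects one unit from the Young-type inequality at exponent
    \<open>r0\<close> and one from passing to the larger exponent \<open>r n\<close>.\<close>
  let ?B = "\<lambda>n \<omega>. 2 + \<bar>V n \<omega>\<bar> powr r n + ?c n \<omega> ^ (2 * m)"
  note mo = innovation_sum_moments[of B K m, OF B m0]
  have w0: "(\<lambda>n. w n * 2) \<longlonglongrightarrow> 0" using w_power[of 1] by (intro tendsto_mult_left_zero) simp
  have int: "integrable M (?B n)" for n using r(2) mo(1) by auto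
  have lim: "(\<lambda>n. w n * (\<integral>\<omega>. ?B n \<omega> \<partial>M)) \<longlonglongrightarrow> 0"
    using tendsto_add[OF tendsto_add[OF w0 r(3)] mo(2)] r(2) mo(1) by (simp add: prob_space distrib_left)
  have le: "AE \<omega> in M. \<bar>(V n \<omega> * ?c n \<omega>)\<^sup>2\<bar> \<le> ?B n \<omega>" for n
  proof (rule AE_I2)
    fix \<omega>
    show "\<bar>(V n \<omega> * ?c n \<omega>)\<^sup>2\<bar> \<le> ?B n \<omega>"
      using m[of "V n \<omega>" "?c n \<omega>"] powr_le_one_plus_powr[of r0 "r n" "V n \<omega>"] r(1)[of n] r0 by simp
  qed
  have adapted: "(\<lambda>\<omega>. V n \<omega> * ?c n \<omega>) \<in> borel_measurable (F n)" for n
    by (intro borel_measurable_times V innovation_sum_adapted)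
  have meas: "(\<lambda>\<omega>. (V n \<omega> * ?c n \<omega>)\<^sup>2) \<in> borel_measurable M" for n
    using measurable_past[OF adapted[of n]] by measurable
  show ?thesis
    unfolding square_negligible_def
    using adapted negligible_dominated[OF meas int lim le] by auto
qed

text \<open>Pythagoras for the orthonormal innovations, used to bound \<open>beta\<close>.
  Integrability of the sum itself is carried along in the induction, because the cross term with the
  next innovation requires it.\<close>

lemma innovation_sum_square:
  fixes B :: "nat \<Rightarrow> real"
  shows "integrable M (\<lambda>\<omega>. (\<Sum>k<n. B k * eta k \<omega>)\<^sup>2)"
    and "(\<integral>\<omega>. (\<Sum>k<n. B k * eta k \<omega>)\<^sup>2 \<partial>M) = (\<Sum>k<n. (B k)\<^sup>2)"
proof -
  let ?S = "\<lambda>n \<omega>. \<Sum>k<n. B k * eta k \<omega>"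
  have "integrable M (?S n) \<and> integrable M (\<lambda>\<omega>. (?S n \<omega>)\<^sup>2) \<and> (\<integral>\<omega>. (?S n \<omega>)\<^sup>2 \<partial>M) = (\<Sum>k<n. (B k)\<^sup>2)"
  proof (induction n)
    case (Suc n)
    have 1: "(\<lambda>_. (B n)\<^sup>2) \<in> borel_measurable (F n)" "integrable M (\<lambda>_. (B n)\<^sup>2)" by auto
    have 2: "(\<lambda>\<omega>. 2 * B n * ?S n \<omega>) \<in> borel_measurable (F n)" "integrable M (\<lambda>\<omega>. 2 * B n * ?S n \<omega>)"
      using innovation_sum_adapted Suc by auto
    note p = past_mult_eta[OF 1] past_mult_eta[OF 2]
    have eq: "(?S (Suc n) \<omega>)\<^sup>2 = (?S n \<omega>)\<^sup>2 + 2 * B n * ?S n \<omega> * eta n \<omega> + (B n)\<^sup>2 * (eta n \<omega>)\<^sup>2" for \<omega>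
      by (simp add: power2_eq_square algebra_simps)
    have "integrable M (?S (Suc n))" using Suc eta_power_integrable[of n 1] by auto
    moreover have "integrable M (\<lambda>\<omega>. (?S (Suc n) \<omega>)\<^sup>2)" unfolding eq using p Suc by auto
    moreover have "(\<integral>\<omega>. (?S (Suc n) \<omega>)\<^sup>2 \<partial>M) = (\<Sum>k<Suc n. (B k)\<^sup>2)"
      unfolding eq using p Suc by (simp add: prob_space)
    ultimately show ?case by blast
  qed auto
  then show "integrable M (\<lambda>\<omega>. (?S n \<omega>)\<^sup>2)" "(\<integral>\<omega>. (?S n \<omega>)\<^sup>2 \<partial>M) = (\<Sum>k<n. (B k)\<^sup>2)"
    by blast+
qed

end

section \<open>The controlled system\<close>

text \<open>For \<theta> > 1 the deficits 1 - \<delta> are summable, so the product converges; this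
  must come first, as \<open>delta_norm\<close> is an infinite product. The partial products
  decrease to it, and the first factor already puts it below 1.\<close>

lemma delta_prod_bounds:
  assumes "tht S > 1"
  shows "delta_norm S \<le> delta_prod S n" "0 < delta_prod S n" "delta_prod S n \<le> 1"
    "0 \<le> delta_norm S" "delta_norm S < 1"
proof -
  have pw: "0 < (real i + 2) powr - tht S" "(real i + 2) powr - tht S < 1" for i
    using assms powr_less_mono[of "- tht S" 0 "real i + 2"] by auto
  have d: "0 < delta S i" "delta S i < 1" for i
    using pw[of i] by (auto simp: delta_def)
  show pos: "0 < delta_prod S n" for n
    unfolding delta_prod_def by (intro prod_pos) (use d in auto)
  show "delta_prod S n \<le> 1"
    unfolding delta_prod_def by (intro prod_le_1) (use d less_imp_le in blast)
  have dp: "delta_prod S (Suc n) = (\<Prod>i\<le>n. delta S (Suc i))" for n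
    unfolding delta_prod_def One_nat_def prod.atLeast1_atMost_eq lessThan_Suc_atMost ..
  have "summable (\<lambda>n. real n powr - tht S)"
    using assms by (simp add: summable_real_powr_iff)
  then have "summable (\<lambda>n. real (n + 3) powr - tht S)"
    by (rule summable_ignore_initial_segment)
  then have "summable (\<lambda>n. \<bar>- ((real (Suc n) + 2) powr (- tht S))\<bar>)"
    by (simp add: algebra_simps)
  moreover have "- ((real (Suc n) + 2) powr (- tht S)) \<noteq> -1" for n
    using pw(2)[of "Suc n"] by linarith
  ultimately have "convergent_prod (\<lambda>n. 1 + - ((real (Suc n) + 2) powr (- tht S)))"
    by (rule summable_imp_convergent_prod_real)
  then have "convergent_prod (\<lambda>n. delta S (Suc n))"
    by (simp add: delta_def)
  then have lim: "(\<lambda>n. delta_prod S (Suc n)) \<longlonglongrightarrow> delta_norm S"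
    unfolding dp delta_norm_def by (rule convergent_prod_LIMSEQ)
  have step: "delta_prod S (Suc n) \<le> delta_prod S n" for n
    using pos[of n] d[of "Suc n"] by (simp add: delta_prod_def mult_left_le)
  then have dec: "decseq (delta_prod S)" by (simp add: decseq_Suc_iff)
  have lim': "delta_prod S \<longlonglongrightarrow> delta_norm S"
    using LIMSEQ_imp_Suc[OF lim] .
  show "delta_norm S \<le> delta_prod S n" by (rule decseq_ge[OF dec lim'])
  show "0 \<le> delta_norm S"
    by (rule LIMSEQ_le_const[OF lim']) (use pos less_imp_le in blast)
  have "delta_norm S \<le> delta_prod S 1" by (rule decseq_ge[OF dec lim'])
  also have "\<dots> < 1" using d[of 1] by (simp add: delta_prod_def)
  finally show "delta_norm S < 1" .
qed

lemma sigma_sets_Int_closed: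
  assumes "A \<subseteq> Pow \<Omega>" "a \<in> sigma_sets \<Omega> A" "b \<in> sigma_sets \<Omega> A"
  shows "a \<inter> b \<in> sigma_sets \<Omega> A"
proof -
  interpret sigma_algebra \<Omega> "sigma_sets \<Omega> A" by (rule sigma_algebra_sigma_sets) (rule assms)
  show ?thesis using assms by auto
qed

locale controlled_system =
  fixes S :: "'a control_problem"
  assumes noise: "noise_setup S" and coeff: "coefficient_setup S"
    and A1: "A1 S" and A2: "A2 S"
begin

lemma exponents: "1 < expa S" "1 \<le> expb S" "0 < lam S" "1 < gam S" "1 < tht S"
  using coeff by (auto simp: coefficient_setup_def)

text \<open>Strictness comes from a |\<delta>|^2 \<ge> b \<ge> 1 together with |\<delta>| < 1:
  dropping one factor |\<delta>| strictly increases the product. This gap above 2 is the margin for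
  products with \<open>xi_pred\<close>.\<close>

lemma exponent_bounds:
  "2 < 2 * expa S * delta_norm S" "2 * expa S * delta_norm S \<le> fwd_exp S n" "2 \<le> bwd_exp S n"
proof -
  note d = delta_prod_bounds[OF exponents(5)]
  have "1 \<le> expa S * (delta_norm S)\<^sup>2" using A1 by (auto simp: A1_def)
  moreover have "expa S * (delta_norm S)\<^sup>2 < expa S * delta_norm S"
  proof -
    have "delta_norm S \<noteq> 0" using \<open>1 \<le> expa S * (delta_norm S)\<^sup>2\<close> by auto
    then have "0 < delta_norm S" using d(4) by linarith
    then have "delta_norm S * delta_norm S < delta_norm S * 1"
      using d(5) by (intro mult_strict_left_mono) auto
    then show ?thesis using exponents(1) by (simp add: power2_eq_square)
  qed
  ultimately show "2 < 2 * expa S * delta_norm S" by linarith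
  show "2 * expa S * delta_norm S \<le> fwd_exp S n"
    unfolding fwd_exp_def using d(1)[of n] exponents(1) by (intro mult_left_mono) auto
  show "2 \<le> bwd_exp S n"
    unfolding bwd_exp_def using d(2,3)[of n] exponents(2) by (simp add: le_divide_eq)
qed

section \<open>The filtration and its independence from the next innovation\<close>

lemma prob_space_prb: "prob_space (prb S)"
  using noise by (simp add: noise_setup_def)

lemma eta_measurable_prb: "eta S n \<in> borel_measurable (prb S)"
  using noise unfolding noise_setup_def distributed_def by simp

lemma xi_eta: "\<omega> \<in> space (prb S) \<Longrightarrow> xi S n \<omega> = (\<Sum>k\<le>n. beta S n k * eta S k \<omega>)"
  and eta_xi: "\<omega> \<in> space (prb S) \<Longrightarrow> eta S n \<omega> = (\<Sum>k\<le>n. alpha S n k * xi S k \<omega>)"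
  and alpha_upper: "n < k \<Longrightarrow> alpha S n k = 0"
  using noise unfolding noise_setup_def by blast+

lemma xi_measurable: "xi S n \<in> borel_measurable (prb S)"
proof -
  have "(\<lambda>\<omega>. \<Sum>k\<le>n. beta S n k * eta S k \<omega>) \<in> borel_measurable (prb S)"
    using eta_measurable_prb by measurable
  then show ?thesis
    by (subst measurable_cong[OF xi_eta])
qed

lemma init_subalgebra: "subalgebra (prb S) (init_alg S)"
  using noise by (simp add: noise_setup_def)

lemma filt_generator_sets:
  "sets (init_alg S) \<union> {xi S k -` A \<inter> space (prb S) | k A. k < n \<and> A \<in> sets borel} \<subseteq> sets (prb S)"
  using init_subalgebra xi_measurable by (auto simp: subalgebra_def measurable_sets)

lemma sets_filt: "sets (filt S n) = sigma_sets (space (prb S))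
     (sets (init_alg S) \<union> {xi S k -` A \<inter> space (prb S) | k A. k < n \<and> A \<in> sets borel})"
  unfolding filt_def using filt_generator_sets sets.space_closed
  by (intro sets_measure_of) blast

lemma space_filt: "space (filt S n) = space (prb S)"
  unfolding filt_def using filt_generator_sets sets.space_closed
  by (intro space_measure_of) blast

lemma filt_subalgebra: "subalgebra (prb S) (filt S n)"
  unfolding subalgebra_def sets_filt space_filt
  using sets.sigma_sets_subset[OF filt_generator_sets] by simp

lemma filt_Suc: "subalgebra (filt S (Suc n)) (filt S n)"
  unfolding subalgebra_def sets_filt space_filt
  by (auto intro!: sigma_sets_mono' simp: less_Suc_eq)

lemma xi_filt: "k < n \<Longrightarrow> xi S k \<in> borel_measurable (filt S n)"
  by (rule measurableI) (auto simp: space_filt sets_filt intro!: sigma_sets.Basic)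

lemma eta_filt: "eta S n \<in> borel_measurable (filt S (Suc n))"
proof -
  have "(\<lambda>\<omega>. \<Sum>k\<le>n. alpha S n k * xi S k \<omega>) \<in> borel_measurable (filt S (Suc n))"
    by (intro borel_measurable_sum borel_measurable_times xi_filt) auto
  then show ?thesis
    by (subst measurable_cong[OF eta_xi]) (auto simp: space_filt)
qed

text \<open>The increments before time n are linear in the innovations before n, and these are
  jointly independent of the n-th one.\<close>

lemma xi_past_indep_eta:
  assumes b: "b \<in> sigma_sets (space (prb S)) {xi S k -` A \<inter> space (prb S) | k A. k < n \<and> A \<in> sets borel}"
    and A: "A \<in> sets borel"
  shows "measure (prb S) (b \<inter> (eta S n -` A \<inter> space (prb S)))
      = measure (prb S) b * measure (prb S) (eta S n -` A \<inter> space (prb S))"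
proof -
  interpret prob_space "prb S" by (rule prob_space_prb)
  have iv: "indep_vars (\<lambda>_. borel) (eta S) UNIV" using noise by (simp add: noise_setup_def)
  let ?X = "\<lambda>\<omega>. restrict (\<lambda>i. eta S i \<omega>) {..<n}" and ?Y = "\<lambda>\<omega>. restrict (\<lambda>i. eta S i \<omega>) {n}"
  let ?PX = "PiM {..<n} (\<lambda>_. borel :: real measure)" and ?PY = "PiM {n} (\<lambda>_. borel :: real measure)"
  have "indep_var ?PX ?X ?PY ?Y"
    by (rule indep_var_restrict[OF iv]) auto
  then have ind: "indep_set (sigma_sets (space (prb S)) {?X -` A \<inter> space (prb S) | A. A \<in> sets ?PX})
      (sigma_sets (space (prb S)) {?Y -` A \<inter> space (prb S) | A. A \<in> sets ?PY})"
    unfolding indep_var_eq by blast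
  have "{xi S k -` A \<inter> space (prb S) | k A. k < n \<and> A \<in> sets borel}
      \<subseteq> sigma_sets (space (prb S)) {?X -` A \<inter> space (prb S) | A. A \<in> sets ?PX}"
  proof clarify
    fix k and A :: "real set" assume k: "k < n" and A: "A \<in> sets borel"
    \<comment> \<open>The \<open>beta\<close> expansion recovers \<open>xi k\<close> from the block
      of innovations below n, since k < n.\<close>
    let ?g = "\<lambda>f. \<Sum>j\<le>k. beta S k j * f j"
    have "?g \<in> borel_measurable ?PX"
      using k by (intro borel_measurable_sum borel_measurable_times measurable_component_singleton) auto
    then have "?g -` A \<inter> space ?PX \<in> sets ?PX" using A by (rule measurable_sets)
    moreover have "xi S k -` A \<inter> space (prb S) = ?X -` (?g -` A \<inter> space ?PX) \<inter> space (prb S)"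
      using k xi_eta[of _ k] by (auto simp: space_PiM)
    ultimately show "xi S k -` A \<inter> space (prb S) \<in> sigma_sets (space (prb S)) {?X -` A \<inter> space (prb S) | A. A \<in> sets ?PX}"
      by (intro sigma_sets.Basic) blast
  qed
  then have b': "b \<in> sigma_sets (space (prb S)) {?X -` A \<inter> space (prb S) | A. A \<in> sets ?PX}"
    using b sigma_sets_mono by blast
  let ?h = "\<lambda>f :: nat \<Rightarrow> real. f n"
  have "?h \<in> borel_measurable ?PY" by (intro measurable_component_singleton) auto
  then have "?h -` A \<inter> space ?PY \<in> sets ?PY" using A by (rule measurable_sets)
  moreover have "eta S n -` A \<inter> space (prb S) = ?Y -` (?h -` A \<inter> space ?PY) \<inter> space (prb S)"
    by (auto simp: space_PiM)
  ultimately have "eta S n -` A \<inter> space (prb S) \<in> sigma_sets (space (prb S)) {?Y -` A \<inter> space (prb S) | A. A \<in> sets ?PY}"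
    by (intro sigma_sets.Basic) blast
  then show ?thesis by (rule indep_setD[OF ind b'])
qed

text \<open>For a initial, b in the past of \<open>xi\<close> and y an event of the innovation, both
  b and b \<inter> y lie in the sigma-algebra of all increments. Independence of the initial data
  splits off a, and \<open>xi_past_indep_eta\<close> separates b from y.\<close>

lemma filt_indep_eta:
  "prob_space.indep_set (prb S) (sets (filt S n))
     (sigma_sets (space (prb S)) {eta S n -` A \<inter> space (prb S) | A. A \<in> sets borel})"
proof -
  interpret prob_space "prb S" by (rule prob_space_prb)
  let ?O = "space (prb S)"
  let ?gen = "\<lambda>n. {xi S k -` A \<inter> ?O | k A. k < n \<and> A \<in> sets borel}"
  let ?all = "sigma_sets ?O {xi S k -` A \<inter> ?O | k A. A \<in> sets borel}"
  have indep0: "indep_set (sets (init_alg S)) ?all" using noise by (simp add: noise_setup_def)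
  have init_ev: "sets (init_alg S) \<subseteq> sets (prb S)" "?O \<in> sets (init_alg S)"
    using init_subalgebra sets.top[of "init_alg S"] by (auto simp: subalgebra_def)
  have gen_pow: "?gen n \<subseteq> Pow ?O" "{xi S k -` A \<inter> ?O | k A. A \<in> sets borel} \<subseteq> Pow ?O" by blast+
  have gen_all: "sigma_sets ?O (?gen m) \<subseteq> ?all" for m by (rule sigma_sets_mono') blast
  have all_ev: "?all \<subseteq> sets (prb S)"
    by (rule sets.sigma_sets_subset) (use measurable_sets[OF xi_measurable] in blast)
  have eta_all: "eta S n -` A \<inter> ?O \<in> ?all" if "A \<in> sets borel" for A
  proof -
    let ?A = "{xi S k -` A \<inter> ?O | k A. A \<in> sets borel}"
    have pow: "?A \<subseteq> Pow ?O" by blast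
    note G = sets_measure_of[OF pow] space_measure_of[OF pow]
    have "xi S k \<in> borel_measurable (sigma ?O ?A)" for k
    proof (rule measurableI)
      show "xi S k -` B \<inter> space (sigma ?O ?A) \<in> sets (sigma ?O ?A)" if "B \<in> sets borel" for B
        unfolding G using that by (intro sigma_sets.Basic) blast
    qed simp
    then have "(\<lambda>\<omega>. \<Sum>k\<le>n. alpha S n k * xi S k \<omega>) \<in> borel_measurable (sigma ?O ?A)" by measurable
    then have "eta S n \<in> borel_measurable (sigma ?O ?A)"
      by (subst measurable_cong[OF eta_xi]) (simp_all add: G)
    from measurable_sets[OF this that] show ?thesis unfolding G .
  qed
  \<comment> \<open>Rectangles form a pi-system generating the filtration at time n, so the product
    formula need only be checked on them.\<close>
  let ?P = "{a \<inter> b | a b. a \<in> sets (init_alg S) \<and> b \<in> sigma_sets ?O (?gen n)}"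
  let ?E = "{eta S n -` A \<inter> ?O | A. A \<in> sets borel}"
  have "indep_set ?P ?E"
  proof (rule indep_setI)
    show "?P \<subseteq> events" using init_ev gen_all[of n] all_ev by blast
    show "?E \<subseteq> events" using eta_all all_ev by blast
    fix x y assume "x \<in> ?P" "y \<in> ?E"
    then obtain a b A where a: "a \<in> sets (init_alg S)" and b: "b \<in> sigma_sets ?O (?gen n)"
      and A: "A \<in> sets borel" and xy: "x = a \<inter> b" "y = eta S n -` A \<inter> ?O" by blast
    have b': "b \<in> ?all" using b gen_all by blast
    have "prob (x \<inter> y) = prob (a \<inter> (b \<inter> y))" by (simp add: xy Int_assoc)
    also have "\<dots> = prob a * prob (b \<inter> y)"
      using eta_all[OF A] b' xy by (intro indep_setD[OF indep0 a] sigma_sets_Int_closed[OF gen_pow(2)]) simp_all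
    also have "prob (b \<inter> y) = prob b * prob y" unfolding xy by (rule xi_past_indep_eta[OF b A])
    also have "prob a * (prob b * prob y) = prob x * prob y"
      using indep_setD[OF indep0 a b'] by (simp add: xy)
    finally show "prob (x \<inter> y) = prob x * prob y" .
  qed
  moreover have "Int_stable ?P"
  proof (rule Int_stableI)
    fix x y assume "x \<in> ?P" "y \<in> ?P"
    then obtain a b a' b' where "a \<in> sets (init_alg S)" "a' \<in> sets (init_alg S)"
      "b \<in> sigma_sets ?O (?gen n)" "b' \<in> sigma_sets ?O (?gen n)" "x = a \<inter> b" "y = a' \<inter> b'" by blast
    moreover from this have "x \<inter> y = (a \<inter> a') \<inter> (b \<inter> b')" by blast
    ultimately show "x \<inter> y \<in> ?P"
      using sets.Int[of a "init_alg S" a'] sigma_sets_Int_closed[OF gen_pow(1), of b b'] by blast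
  qed
  moreover have "Int_stable ?E"
  proof (rule Int_stableI)
    fix x y assume "x \<in> ?E" "y \<in> ?E"
    then obtain A B where "A \<in> sets borel" "B \<in> sets borel" "x = eta S n -` A \<inter> ?O" "y = eta S n -` B \<inter> ?O"
      by blast
    then show "x \<inter> y \<in> ?E" by (intro CollectI exI[of _ "A \<inter> B"]) auto
  qed
  ultimately have ind: "indep_set (sigma_sets ?O ?P) (sigma_sets ?O ?E)"
    by (rule indep_set_sigma_sets)
  have "sets (filt S n) \<subseteq> sigma_sets ?O ?P"
    unfolding sets_filt
  proof (intro sigma_sets_mono subsetI, elim UnE)
    fix x assume "x \<in> sets (init_alg S)"
    moreover from this have "x = x \<inter> ?O" using init_ev sets.sets_into_space by blast
    ultimately show "x \<in> sigma_sets ?O ?P" using sigma_sets_top[of ?O "?gen n"] by (intro sigma_sets.Basic) blast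
  next
    fix x assume "x \<in> ?gen n"
    moreover from this have "x = ?O \<inter> x" by blast
    ultimately show "x \<in> sigma_sets ?O ?P" using init_ev by (intro sigma_sets.Basic) blast
  qed
  then show ?thesis
    using ind unfolding indep_sets2_eq by blast
qed

sublocale gaussian_innovations "prb S" "filt S" "eta S" "wt S"
proof (intro gaussian_innovations.intro prob_space_prb gaussian_innovations_axioms.intro)
  interpret prob_space "prb S" by (rule prob_space_prb)
  show "prob_space.indep_var (prb S) borel U borel (eta S n)" if U: "U \<in> borel_measurable (filt S n)" for U n
    unfolding indep_var_eq
  proof (intro conjI)
    show "random_variable borel U" using measurable_from_subalg[OF filt_subalgebra U] .
    show "random_variable borel (eta S n)" by (rule eta_measurable_prb)
    have "{U -` A \<inter> space (prb S) | A. A \<in> sets borel} \<subseteq> sets (filt S n)"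
      using measurable_sets[OF U] by (auto simp: space_filt)
    then have "sigma_sets (space (prb S)) {U -` A \<inter> space (prb S) | A. A \<in> sets borel} \<subseteq> sets (filt S n)"
      using sets.sigma_sets_subset[of _ "filt S n"] by (simp add: space_filt)
    then show "indep_set (sigma_sets (space (prb S)) {U -` A \<inter> space (prb S) | A. A \<in> sets borel})
        (sigma_sets (space (prb S)) {eta S n -` A \<inter> space (prb S) | A. A \<in> sets borel})"
      using filt_indep_eta[of n] unfolding indep_sets2_eq by blast
  qed
  show "(\<lambda>n. wt S n * C ^ n) \<longlonglongrightarrow> 0" for C
    unfolding wt_def by (rule exp_neg_powr_times_power_tendsto_0[OF exponents(3,4)])
  show "distributed (prb S) lborel (eta S n) std_normal_density" for n
    using noise by (simp add: noise_setup_def)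
qed (simp_all add: filt_subalgebra filt_Suc eta_filt wt_def)

section \<open>The predictable part of the noise\<close>

text \<open>A version of the conditional expectation \<open>cond_xi\<close> given by a formula at
  every sample point. Written in innovations rather than increments, its moments are directly
  accessible.\<close>

definition xi_pred :: "nat \<Rightarrow> 'a \<Rightarrow> real" where
  "xi_pred n \<omega> = (\<Sum>k<n. beta S n k * eta S k \<omega>)"

lemma xi_decomp: "\<omega> \<in> space (prb S) \<Longrightarrow> xi S n \<omega> = xi_pred n \<omega> + beta S n n * eta S n \<omega>"
  by (simp add: xi_eta xi_pred_def lessThan_Suc_atMost[symmetric])

lemma xi_pred_adapted: "xi_pred n \<in> borel_measurable (filt S n)"
  unfolding xi_pred_def[abs_def] by (rule innovation_sum_adapted)

text \<open>After exchanging the sums, triangularity of \<open>alpha\<close> cuts the inner one at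
  l, where it is the Gram-Schmidt formula for the l-th innovation. This identifies the sum in the
  variational inequality.\<close>

lemma xi_pred_gammac:
  assumes "\<omega> \<in> space (prb S)"
  shows "(\<Sum>j<n. gammac S n j * xi S j \<omega>) = xi_pred n \<omega>"
proof -
  have "(\<Sum>j<n. gammac S n j * xi S j \<omega>) = (\<Sum>j<n. \<Sum>l<n. beta S n l * (alpha S l j * xi S j \<omega>))"
    by (simp add: gammac_def sum_distrib_right mult.assoc)
  also have "\<dots> = (\<Sum>l<n. \<Sum>j<n. beta S n l * (alpha S l j * xi S j \<omega>))" by (rule sum.swap)
  also have "\<dots> = (\<Sum>l<n. beta S n l * eta S l \<omega>)"
  proof (rule sum.cong[OF refl])
    fix l assume l: "l \<in> {..<n}"
    have "(\<Sum>j<n. alpha S l j * xi S j \<omega>) = (\<Sum>j\<le>l. alpha S l j * xi S j \<omega>)"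
      using l by (intro sum.mono_neutral_right) (auto simp: alpha_upper)
    then show "(\<Sum>j<n. beta S n l * (alpha S l j * xi S j \<omega>)) = beta S n l * eta S l \<omega>"
      using eta_xi[OF assms, of l] by (simp add: sum_distrib_left[symmetric])
  qed
  finally show ?thesis by (simp add: xi_pred_def)
qed

text \<open>Tested against any event of the filtration, the remaining term
  \<open>beta S n n * eta S n\<close> integrates to zero.\<close>

lemma cond_xi_eq: "AE \<omega> in prb S. cond_xi S n \<omega> = xi_pred n \<omega>"
proof -
  interpret finite_measure_subalgebra "prb S" "filt S n"
    by unfold_locales (rule filt_subalgebra)
  have int_pred: "integrable (prb S) (xi_pred n)"
    unfolding xi_pred_def[abs_def] using eta_power_integrable[of _ 1] by auto
  have int_eta: "integrable (prb S) (eta S n)" using eta_power_integrable[of n 1] by simp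
  have int_xi: "integrable (prb S) (xi S n)"
    by (subst Bochner_Integration.integrable_cong[OF refl xi_decomp]) (use int_pred int_eta in auto)
  show ?thesis
    unfolding cond_xi_def
  proof (rule real_cond_exp_charact)
    fix A assume A: "A \<in> sets (filt S n)"
    then have AM: "A \<in> sets (prb S)" using filt_subalgebra by (auto simp: subalgebra_def)
    have ind: "(indicator A :: 'a \<Rightarrow> real) \<in> borel_measurable (filt S n)" using A by simp
    have "integrable (prb S) (indicator A :: 'a \<Rightarrow> real)" using AM by (simp add: emeasure_eq_measure)
    note e = past_mult_eta[OF ind this]
    have i: "integrable (prb S) (\<lambda>\<omega>. indicator A \<omega> * xi_pred n \<omega>)"
      using integrable_mult_indicator[OF AM int_pred] by simp
    have "(\<integral>\<omega>. indicator A \<omega> * xi S n \<omega> \<partial>prb S)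
        = (\<integral>\<omega>. indicator A \<omega> * xi_pred n \<omega> + beta S n n * (indicator A \<omega> * eta S n \<omega>) \<partial>prb S)"
      by (rule Bochner_Integration.integral_cong[OF refl]) (simp add: xi_decomp algebra_simps)
    also have "\<dots> = (\<integral>\<omega>. indicator A \<omega> * xi_pred n \<omega> \<partial>prb S)"
      using e(1,2) i by simp
    finally show "(\<integral>\<omega>\<in>A. xi S n \<omega> \<partial>prb S) = (\<integral>\<omega>\<in>A. xi_pred n \<omega> \<partial>prb S)"
      by (simp add: set_lebesgue_integral_def)
  qed (use int_xi int_pred xi_pred_adapted in auto)
qed

section \<open>Uniform bound on the Gram-Schmidt coefficients\<close>

text \<open>Integrability of the products is read off from the covariance formula: a non-integrable
  function has integral 0, and the values here are positive. At n = 0 the formula yields zero for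
  two of the three products, so this argument starts at n = 1.\<close>

lemma xi_variance:
  assumes "1 \<le> n"
  shows "(\<integral>\<omega>. (xi S n \<omega>)\<^sup>2 \<partial>prb S) = 1"
proof -
  have H: "0 < hurst S" and cov: "\<And>s t. 0 \<le> s \<Longrightarrow> 0 \<le> t \<Longrightarrow> (\<integral>\<omega>. fbm S s \<omega> * fbm S t \<omega> \<partial>prb S)
        = (s powr (2 * hurst S) + t powr (2 * hurst S) - \<bar>t - s\<bar> powr (2 * hurst S)) / 2"
    using noise by (auto simp: noise_setup_def fractional_brownian_motion_def)
  let ?n = "real n" and ?H = "2 * hurst S"
  have E: "(\<integral>\<omega>. fbm S ?n \<omega> * fbm S ?n \<omega> \<partial>prb S) = ?n powr ?H"
    "(\<integral>\<omega>. fbm S (?n + 1) \<omega> * fbm S (?n + 1) \<omega> \<partial>prb S) = (?n + 1) powr ?H"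
    "(\<integral>\<omega>. fbm S (?n + 1) \<omega> * fbm S ?n \<omega> \<partial>prb S) = (?n powr ?H + (?n + 1) powr ?H - 1) / 2"
    using cov[of ?n ?n] cov[of "?n + 1" "?n + 1"] cov[of "?n + 1" ?n] by simp_all
  have p: "1 \<le> ?n powr ?H" "0 < (?n + 1) powr ?H"
    using assms H ge_one_powr_ge_zero[of ?n ?H] by auto
  have "0 < (r + s - 1) / 2" if "1 \<le> r" "0 < s" for r s :: real
    using that by simp
  from this[OF p] assms have "0 < ?n powr ?H" "0 < (?n powr ?H + (?n + 1) powr ?H - 1) / 2"
    by simp_all
  with p(2) have I: "integrable (prb S) (\<lambda>\<omega>. fbm S ?n \<omega> * fbm S ?n \<omega>)"
    "integrable (prb S) (\<lambda>\<omega>. fbm S (?n + 1) \<omega> * fbm S (?n + 1) \<omega>)"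
    "integrable (prb S) (\<lambda>\<omega>. fbm S (?n + 1) \<omega> * fbm S ?n \<omega>)"
    using E not_integrable_integral_eq by (metis less_irrefl)+
  have "(xi S n \<omega>)\<^sup>2 = fbm S (?n + 1) \<omega> * fbm S (?n + 1) \<omega>
      - 2 * (fbm S (?n + 1) \<omega> * fbm S ?n \<omega>) + fbm S ?n \<omega> * fbm S ?n \<omega>" for \<omega>
    by (simp add: xi_def power2_eq_square algebra_simps)
  then show ?thesis using I E by simp
qed

lemma beta_bounded: "\<exists>K. \<forall>n k. \<bar>beta S n k\<bar> \<le> K"
proof -
  have upper: "beta S n k = 0" if "n < k" for n k
    using noise that unfolding noise_setup_def by blast
  have "\<bar>beta S n k\<bar> \<le> 1" if n: "1 \<le> n" and k: "k \<le> n" for n k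
  proof -
    have "(\<integral>\<omega>. (xi S n \<omega>)\<^sup>2 \<partial>prb S) = (\<integral>\<omega>. (\<Sum>k<Suc n. beta S n k * eta S k \<omega>)\<^sup>2 \<partial>prb S)"
      by (rule Bochner_Integration.integral_cong[OF refl]) (simp add: xi_eta lessThan_Suc_atMost)
    then have sum: "(\<Sum>k<Suc n. (beta S n k)\<^sup>2) = 1"
      using xi_variance[OF n] innovation_sum_square(2)[of "beta S n" "Suc n"] by simp
    have "(beta S n k)\<^sup>2 \<le> (\<Sum>k<Suc n. (beta S n k)\<^sup>2)" using k by (intro member_le_sum) auto
    then show ?thesis using sum by (simp add: abs_square_le_1)
  qed
  note le1 = this
  \<comment> \<open>For n \<ge> 1 the squared coefficients in a row sum to the variance 1. The row
    of time 0 has a single entry, which is simply added to the bound.\<close>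
  have "\<bar>beta S n k\<bar> \<le> 1 + \<bar>beta S 0 0\<bar>" for n k
  proof (cases "k \<le> n \<and> 1 \<le> n")
    case True
    then show ?thesis using le1[of n k] by linarith
  next
    case False
    then have "n < k \<or> n = 0 \<and> k = 0" by linarith
    then show ?thesis using upper[of n k] by auto
  qed
  then show ?thesis by blast
qed

section \<open>The solution spaces and the coefficients along solutions\<close>

lemma fwd_space_diff_negligible:
  assumes "U \<in> fwd_space S" "V \<in> fwd_space S"
  shows "(\<lambda>n \<omega>. U n \<omega> - V n \<omega>) \<in> square_negligible"
    and "(\<lambda>n \<omega>. (U n \<omega> - V n \<omega>) * xi_pred n \<omega>) \<in> square_negligible"
proof -
  obtain K where K: "\<And>n k. \<bar>beta S n k\<bar> \<le> K" using beta_bounded by blast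
  have *: "W \<in> square_negligible \<and> (\<lambda>n \<omega>. W n \<omega> * xi_pred n \<omega>) \<in> square_negligible" if "W \<in> fwd_space S" for W
  proof -
    have W: "W n \<in> borel_measurable (filt S n)" "integrable (prb S) (\<lambda>\<omega>. \<bar>W n \<omega>\<bar> powr fwd_exp S n)"
      "(\<lambda>n. wt S n * (\<integral>\<omega>. \<bar>W n \<omega>\<bar> powr fwd_exp S n \<partial>prb S)) \<longlonglongrightarrow> 0" for n
      using that summable_LIMSEQ_zero unfolding fwd_space_def weighted_space_def adapted_def by blast+
    have 2: "2 \<le> fwd_exp S n" for n using exponent_bounds(1,2) by (meson less_imp_le order_trans)
    show ?thesis
      using square_negligible_of_powr[OF W(1) 2 W(2,3)]
        square_negligible_mult_innovation_sum[OF W(1) exponent_bounds(1,2) W(2,3) K]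
      by (simp add: xi_pred_def[abs_def])
  qed
  show "(\<lambda>n \<omega>. U n \<omega> - V n \<omega>) \<in> square_negligible"
    using assms * by (intro square_negligible_diff) auto
  show "(\<lambda>n \<omega>. (U n \<omega> - V n \<omega>) * xi_pred n \<omega>) \<in> square_negligible"
    unfolding left_diff_distrib using assms * by (intro square_negligible_diff) auto
qed

text \<open>Here the exponents are only known to be at least 2, which leaves no established margin
  for \<open>xi_pred\<close>. In all later products that factor is therefore attached to a forward
  process.\<close>

lemma bwd_space_negligible:
  assumes "W \<in> bwd_space S"
  shows "W \<in> square_negligible"
proof -
  have W: "W n \<in> borel_measurable (filt S n)" "integrable (prb S) (\<lambda>\<omega>. \<bar>W n \<omega>\<bar> powr bwd_exp S n)"
    "(\<lambda>n. wt S n * (\<integral>\<omega>. \<bar>W n \<omega>\<bar> powr bwd_exp S n \<partial>prb S)) \<longlonglongrightarrow> 0" for n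
    using assms summable_LIMSEQ_zero unfolding bwd_space_def weighted_space_def adapted_def by blast+
  show ?thesis by (rule square_negligible_of_powr[OF W(1) exponent_bounds(3) W(2,3)])
qed

lemma coefficients_differentiable:
  assumes "\<omega> \<in> space (prb S)"
  shows "(\<lambda>(x, u). drift S n \<omega> x u) differentiable (at v)"
    and "(\<lambda>(x, u). vol S n \<omega> x u) differentiable (at v)"
    and "(\<lambda>(x, y, z, u). gen S n \<omega> x y z u) differentiable (at v')"
  using coeff assms unfolding coefficient_setup_def by blast+

text \<open>\<open>A1\<close> gives adaptedness for constant arguments only; continuity in the
  arguments extends it to adapted ones. The same reasoning applies to \<open>vol\<close> and
  \<open>gen\<close>.\<close>

lemma drift_adapted:
  assumes "X \<in> borel_measurable (filt S n)" "u \<in> borel_measurable (filt S n)"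
  shows "(\<lambda>\<omega>. drift S n \<omega> (X \<omega>) (u \<omega>)) \<in> borel_measurable (filt S n)"
proof -
  have "(\<lambda>\<omega>. (case (X \<omega>, u \<omega>) of (x, u) \<Rightarrow> drift S n \<omega> x u)) \<in> borel_measurable (filt S n)"
  proof (rule borel_measurable_Caratheodory[where g = "\<lambda>\<omega> v. case v of (x, u) \<Rightarrow> drift S n \<omega> x u"])
    show "(\<lambda>\<omega>. (X \<omega>, u \<omega>)) \<in> borel_measurable (filt S n)" using assms by (rule borel_measurable_Pair)
    show "(\<lambda>\<omega>. case v of (x, u) \<Rightarrow> drift S n \<omega> x u) \<in> borel_measurable (filt S n)" for v
      using A1 by (cases v) (simp add: A1_def fwd_space_def weighted_space_def adapted_def)
    show "continuous_on UNIV (\<lambda>v. case v of (x, u) \<Rightarrow> drift S n \<omega> x u)" if "\<omega> \<in> space (filt S n)" for \<omega>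
      using coefficients_differentiable(1)[of \<omega> n] that differentiable_imp_continuous_within
      by (force simp: continuous_on_eq_continuous_within)
  qed
  then show ?thesis by simp
qed

lemma vol_adapted:
  assumes "X \<in> borel_measurable (filt S n)" "u \<in> borel_measurable (filt S n)"
  shows "(\<lambda>\<omega>. vol S n \<omega> (X \<omega>) (u \<omega>)) \<in> borel_measurable (filt S n)"
proof -
  have "(\<lambda>\<omega>. (case (X \<omega>, u \<omega>) of (x, u) \<Rightarrow> vol S n \<omega> x u)) \<in> borel_measurable (filt S n)"
  proof (rule borel_measurable_Caratheodory[where g = "\<lambda>\<omega> v. case v of (x, u) \<Rightarrow> vol S n \<omega> x u"])
    show "(\<lambda>\<omega>. (X \<omega>, u \<omega>)) \<in> borel_measurable (filt S n)" using assms by (rule borel_measurable_Pair)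
    show "(\<lambda>\<omega>. case v of (x, u) \<Rightarrow> vol S n \<omega> x u) \<in> borel_measurable (filt S n)" for v
      using A1 by (cases v) (simp add: A1_def fwd_space_def weighted_space_def adapted_def)
    show "continuous_on UNIV (\<lambda>v. case v of (x, u) \<Rightarrow> vol S n \<omega> x u)" if "\<omega> \<in> space (filt S n)" for \<omega>
      using coefficients_differentiable(2)[of \<omega> n] that differentiable_imp_continuous_within
      by (force simp: continuous_on_eq_continuous_within)
  qed
  then show ?thesis by simp
qed

lemma gen_adapted:
  assumes "X \<in> borel_measurable (filt S n)" "Y \<in> borel_measurable (filt S n)"
    "Z \<in> borel_measurable (filt S n)" "u \<in> borel_measurable (filt S n)"
  shows "(\<lambda>\<omega>. gen S n \<omega> (X \<omega>) (Y \<omega>) (Z \<omega>) (u \<omega>)) \<in> borel_measurable (filt S n)"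
proof -
  have "(\<lambda>\<omega>. (case (X \<omega>, Y \<omega>, Z \<omega>, u \<omega>) of (x, y, z, u) \<Rightarrow> gen S n \<omega> x y z u)) \<in> borel_measurable (filt S n)"
  proof (rule borel_measurable_Caratheodory[where g = "\<lambda>\<omega> v. case v of (x, y, z, u) \<Rightarrow> gen S n \<omega> x y z u"])
    show "(\<lambda>\<omega>. (X \<omega>, Y \<omega>, Z \<omega>, u \<omega>)) \<in> borel_measurable (filt S n)"
      using assms by (intro borel_measurable_Pair)
    show "(\<lambda>\<omega>. case v of (x, y, z, u) \<Rightarrow> gen S n \<omega> x y z u) \<in> borel_measurable (filt S n)" for v
      using A1 by (cases v) (simp add: A1_def bwd_space_def weighted_space_def adapted_def)
    show "continuous_on UNIV (\<lambda>v. case v of (x, y, z, u) \<Rightarrow> gen S n \<omega> x y z u)" if "\<omega> \<in> space (filt S n)" for \<omega>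
      using coefficients_differentiable(3)[of \<omega> n] that differentiable_imp_continuous_within
      by (force simp: continuous_on_eq_continuous_within)
  qed
  then show ?thesis by simp
qed

lemma coefficients_Lipschitz:
  obtains L where "0 < L"
    and "\<And>n \<omega> x1 x2 u1 u2. \<omega> \<in> space (prb S) \<Longrightarrow>
      \<bar>drift S n \<omega> x1 u1 - drift S n \<omega> x2 u2\<bar> \<le> L * (\<bar>x1 - x2\<bar> + \<bar>u1 - u2\<bar>)"
    and "\<And>n \<omega> x1 x2 u1 u2. \<omega> \<in> space (prb S) \<Longrightarrow>
      \<bar>vol S n \<omega> x1 u1 - vol S n \<omega> x2 u2\<bar> \<le> L * (\<bar>x1 - x2\<bar> + \<bar>u1 - u2\<bar>)"
    and "\<And>n \<omega> x1 x2 y1 y2 z1 z2 u1 u2. \<omega> \<in> space (prb S) \<Longrightarrow>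
      \<bar>gen S n \<omega> x1 y1 z1 u1 - gen S n \<omega> x2 y2 z2 u2\<bar>
        \<le> L * (\<bar>x1 - x2\<bar> + \<bar>y1 - y2\<bar> + \<bar>z1 - z2\<bar> + \<bar>u1 - u2\<bar>)"
proof -
  obtain L where L: "0 < L" and *: "\<forall>n. \<forall>\<omega>\<in>space (prb S).
     (\<forall>x1 x2 u1 u2.
        \<bar>drift S n \<omega> x1 u1 - drift S n \<omega> x2 u2\<bar> + \<bar>vol S n \<omega> x1 u1 - vol S n \<omega> x2 u2\<bar>
          \<le> L * (\<bar>x1 - x2\<bar> + \<bar>u1 - u2\<bar>)) \<and>
     (\<forall>x1 x2 y1 y2 z1 z2 u1 u2.
        \<bar>gen S n \<omega> x1 y1 z1 u1 - gen S n \<omega> x2 y2 z2 u2\<bar>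
          \<le> L * (\<bar>x1 - x2\<bar> + \<bar>y1 - y2\<bar> + \<bar>z1 - z2\<bar> + \<bar>u1 - u2\<bar>))"
    using A2 unfolding A2_def by (elim exE conjE)
  show ?thesis
  proof (rule that[OF L])
    fix n \<omega> x1 x2 u1 u2 assume "\<omega> \<in> space (prb S)"
    then have "\<bar>drift S n \<omega> x1 u1 - drift S n \<omega> x2 u2\<bar> + \<bar>vol S n \<omega> x1 u1 - vol S n \<omega> x2 u2\<bar>
          \<le> L * (\<bar>x1 - x2\<bar> + \<bar>u1 - u2\<bar>)"
      using * by blast
    then
    show "\<bar>drift S n \<omega> x1 u1 - drift S n \<omega> x2 u2\<bar> \<le> L * (\<bar>x1 - x2\<bar> + \<bar>u1 - u2\<bar>)"
      and "\<bar>vol S n \<omega> x1 u1 - vol S n \<omega> x2 u2\<bar> \<le> L * (\<bar>x1 - x2\<bar> + \<bar>u1 - u2\<bar>)"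
      by linarith+
  qed (use * in blast)
qed

text \<open>The sample point and \<open>p\<close>, \<open>q\<close>, \<open>k\<close> are frozen, so
  this is a deterministic tangent inequality. The gradient is spelled out in the grouping used by
  the adjoint equations and the variational inequality.\<close>

lemma hamiltonian_above_tangent_plane:
  assumes \<omega>: "\<omega> \<in> space (prb S)"
    and conv: "convex_on UNIV (\<lambda>(x, y, z, u). hamiltonian S n \<omega> x y z u p q k)"
  shows "hamiltonian S n \<omega> x0 y0 z0 u0 p q k
      + (deriv (\<lambda>x. drift S n \<omega> x u0) x0 * p + deriv (\<lambda>x. vol S n \<omega> x u0) x0 * p * cond_xi S n \<omega>
          + beta S n n * deriv (\<lambda>x. vol S n \<omega> x u0) x0 * q - deriv (\<lambda>x. gen S n \<omega> x y0 z0 u0) x0 * k) * (x - x0)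
      - deriv (\<lambda>y. gen S n \<omega> x0 y z0 u0) y0 * k * (y - y0)
      - deriv (\<lambda>z. gen S n \<omega> x0 y0 z u0) z0 * k * (z - z0)
      + (deriv (drift S n \<omega> x0) u0 * p + deriv (vol S n \<omega> x0) u0 * p * cond_xi S n \<omega>
          + beta S n n * deriv (vol S n \<omega> x0) u0 * q - deriv (gen S n \<omega> x0 y0 z0) u0 * k) * (u - u0)
    \<le> hamiltonian S n \<omega> x y z u p q k"
proof -
  let ?v = "(x0, y0, z0, u0)"
  \<comment> \<open>\<open>drift\<close> and \<open>vol\<close> see only the first and last
    coordinates; their derivatives are pulled back along this projection.\<close>
  have proj: "((\<lambda>v. (fst v, snd (snd (snd v)))) has_derivative (\<lambda>v. (fst v, snd (snd (snd v))))) (at ?v)"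
    by (auto intro!: derivative_eq_intros)
  have b: "((\<lambda>v. drift S n \<omega> (fst v) (snd (snd (snd v)))) has_derivative
      (\<lambda>v. fst v * deriv (\<lambda>x. drift S n \<omega> x u0) x0 + snd (snd (snd v)) * deriv (drift S n \<omega> x0) u0)) (at ?v)"
  proof -
    have "((\<lambda>v. (\<lambda>(x, u). drift S n \<omega> x u) (fst v, snd (snd (snd v)))) has_derivative
      (\<lambda>v. (\<lambda>(s, t). s * deriv (\<lambda>x. drift S n \<omega> x u0) x0 + t * deriv (drift S n \<omega> x0) u0)
          (fst v, snd (snd (snd v))))) (at ?v)"
      by (rule has_derivative_compose[OF proj])
        (simp add: has_derivative_partials2(1)[OF coefficients_differentiable(1)[OF \<omega>]])
    then show ?thesis by simp
  qed
  have s: "((\<lambda>v. vol S n \<omega> (fst v) (snd (snd (snd v)))) has_derivative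
      (\<lambda>v. fst v * deriv (\<lambda>x. vol S n \<omega> x u0) x0 + snd (snd (snd v)) * deriv (vol S n \<omega> x0) u0)) (at ?v)"
  proof -
    have "((\<lambda>v. (\<lambda>(x, u). vol S n \<omega> x u) (fst v, snd (snd (snd v)))) has_derivative
      (\<lambda>v. (\<lambda>(s, t). s * deriv (\<lambda>x. vol S n \<omega> x u0) x0 + t * deriv (vol S n \<omega> x0) u0)
          (fst v, snd (snd (snd v))))) (at ?v)"
      by (rule has_derivative_compose[OF proj])
        (simp add: has_derivative_partials2(1)[OF coefficients_differentiable(2)[OF \<omega>]])
    then show ?thesis by simp
  qed
  note f = has_derivative_partials4(1)[OF coefficients_differentiable(3)[OF \<omega>, of n ?v], unfolded case_prod_beta]
  have ham: "(\<lambda>(x, y, z, u). hamiltonian S n \<omega> x y z u p q k)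
      = (\<lambda>v. drift S n \<omega> (fst v) (snd (snd (snd v))) * p
        + vol S n \<omega> (fst v) (snd (snd (snd v))) * (p * cond_xi S n \<omega> + beta S n n * q)
        - gen S n \<omega> (fst v) (fst (snd v)) (fst (snd (snd v))) (snd (snd (snd v))) * k)"
    by (auto simp: fun_eq_iff hamiltonian_def algebra_simps)
  have D: "((\<lambda>(x, y, z, u). hamiltonian S n \<omega> x y z u p q k) has_derivative
      (\<lambda>v. (fst v * deriv (\<lambda>x. drift S n \<omega> x u0) x0 + snd (snd (snd v)) * deriv (drift S n \<omega> x0) u0) * p
        + (fst v * deriv (\<lambda>x. vol S n \<omega> x u0) x0 + snd (snd (snd v)) * deriv (vol S n \<omega> x0) u0)
            * (p * cond_xi S n \<omega> + beta S n n * q)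
        - (fst v * deriv (\<lambda>x. gen S n \<omega> x y0 z0 u0) x0
             + fst (snd v) * deriv (\<lambda>y. gen S n \<omega> x0 y z0 u0) y0
             + fst (snd (snd v)) * deriv (\<lambda>z. gen S n \<omega> x0 y0 z u0) z0
             + snd (snd (snd v)) * deriv (gen S n \<omega> x0 y0 z0) u0) * k)) (at ?v)"
    unfolding ham by (intro has_derivative_add has_derivative_diff has_derivative_mult_left b s f)
  show ?thesis
    using convex_on_imp_above_tangent_plane[OF conv D, of "(x, y, z, u)"]
    by (simp add: algebra_simps)
qed

end

section \<open>Duality with the adjoint processes\<close>

locale adjoint_system = controlled_system +
  fixes us Xs Ys Zs k p q :: "'a process"
  assumes us: "us \<in> fwd_space S"
    and sys: "system_solution S us Xs Ys Zs"
    and adj_k: "adjoint_forward S us Xs Ys Zs k"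
    and adj_p: "adjoint_backward S us Xs Ys Zs k p q"
begin

lemma space_adapted: "V \<in> fwd_space S \<Longrightarrow> V n \<in> borel_measurable (filt S n)"
  "V \<in> bwd_space S \<Longrightarrow> V n \<in> borel_measurable (filt S n)"
  by (auto simp: fwd_space_def bwd_space_def weighted_space_def adapted_def)

lemma spaces: "Xs \<in> fwd_space S" "Ys \<in> bwd_space S" "Zs \<in> bwd_space S" "p \<in> bwd_space S" "q \<in> bwd_space S"
  using sys adj_p
  by (auto simp: system_solution_def state_solution_def backward_solution_def adjoint_backward_def)

lemmas adapted' = space_adapted(1)[OF us] space_adapted(1)[OF spaces(1)] space_adapted(2)[OF spaces(2)]
  space_adapted(2)[OF spaces(3)]

lemma partials_differentiable:
  assumes "\<omega> \<in> space (prb S)"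
  shows "(\<lambda>x. drift S n \<omega> x (us n \<omega>)) differentiable (at (Xs n \<omega>))"
    "(\<lambda>x. vol S n \<omega> x (us n \<omega>)) differentiable (at (Xs n \<omega>))"
    "(\<lambda>x. gen S n \<omega> x (Ys n \<omega>) (Zs n \<omega>) (us n \<omega>)) differentiable (at (Xs n \<omega>))"
    "(\<lambda>y. gen S n \<omega> (Xs n \<omega>) y (Zs n \<omega>) (us n \<omega>)) differentiable (at (Ys n \<omega>))"
    "(\<lambda>z. gen S n \<omega> (Xs n \<omega>) (Ys n \<omega>) z (us n \<omega>)) differentiable (at (Zs n \<omega>))"
  by (rule has_derivative_partials2(2) has_derivative_partials4(2,3,4),
      rule coefficients_differentiable[OF assms])+

text \<open>The difference quotients are built from coefficients along adapted processes, hence are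
  measurable for the filtration at time n itself.\<close>

lemma partials_adapted:
  "drift_x S us Xs n \<in> borel_measurable (filt S n)"
  "vol_x S us Xs n \<in> borel_measurable (filt S n)"
  "gen_x S us Xs Ys Zs n \<in> borel_measurable (filt S n)"
  "gen_y S us Xs Ys Zs n \<in> borel_measurable (filt S n)"
  "gen_z S us Xs Ys Zs n \<in> borel_measurable (filt S n)"
proof -
  note d = partials_differentiable
  show "drift_x S us Xs n \<in> borel_measurable (filt S n)"
    unfolding drift_x_def[abs_def]
    by (rule borel_measurable_deriv_at[where g = "\<lambda>\<omega> x. drift S n \<omega> x (us n \<omega>)"])
      (simp_all add: drift_adapted adapted' d)
  show "vol_x S us Xs n \<in> borel_measurable (filt S n)"
    unfolding vol_x_def[abs_def]
    by (rule borel_measurable_deriv_at[where g = "\<lambda>\<omega> x. vol S n \<omega> x (us n \<omega>)"])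
      (simp_all add: vol_adapted adapted' d)
  show "gen_x S us Xs Ys Zs n \<in> borel_measurable (filt S n)"
    unfolding gen_x_def[abs_def]
    by (rule borel_measurable_deriv_at[where g = "\<lambda>\<omega> x. gen S n \<omega> x (Ys n \<omega>) (Zs n \<omega>) (us n \<omega>)"])
      (simp_all add: gen_adapted adapted' d)
  show "gen_y S us Xs Ys Zs n \<in> borel_measurable (filt S n)"
    unfolding gen_y_def[abs_def]
    by (rule borel_measurable_deriv_at[where g = "\<lambda>\<omega> y. gen S n \<omega> (Xs n \<omega>) y (Zs n \<omega>) (us n \<omega>)"])
      (simp_all add: gen_adapted adapted' d)
  show "gen_z S us Xs Ys Zs n \<in> borel_measurable (filt S n)"
    unfolding gen_z_def[abs_def]
    by (rule borel_measurable_deriv_at[where g = "\<lambda>\<omega> z. gen S n \<omega> (Xs n \<omega>) (Ys n \<omega>) z (us n \<omega>)"])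
      (simp_all add: gen_adapted adapted' d)
qed

text \<open>Boundedness keeps a partial derivative times a square-negligible process in that class,
  and controls the growth of \<open>kad\<close>.\<close>

lemma partials_bounded:
  "\<exists>L. \<forall>n. \<forall>\<omega>\<in>space (prb S). \<bar>drift_x S us Xs n \<omega>\<bar> \<le> L \<and> \<bar>vol_x S us Xs n \<omega>\<bar> \<le> L \<and>
     \<bar>gen_x S us Xs Ys Zs n \<omega>\<bar> \<le> L \<and> \<bar>gen_y S us Xs Ys Zs n \<omega>\<bar> \<le> L \<and> \<bar>gen_z S us Xs Ys Zs n \<omega>\<bar> \<le> L"
proof -
  obtain L where L: "0 < L"
    "\<And>n \<omega> x1 x2 u1 u2. \<omega> \<in> space (prb S) \<Longrightarrow>
      \<bar>drift S n \<omega> x1 u1 - drift S n \<omega> x2 u2\<bar> \<le> L * (\<bar>x1 - x2\<bar> + \<bar>u1 - u2\<bar>)"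
    "\<And>n \<omega> x1 x2 u1 u2. \<omega> \<in> space (prb S) \<Longrightarrow>
      \<bar>vol S n \<omega> x1 u1 - vol S n \<omega> x2 u2\<bar> \<le> L * (\<bar>x1 - x2\<bar> + \<bar>u1 - u2\<bar>)"
    "\<And>n \<omega> x1 x2 y1 y2 z1 z2 u1 u2. \<omega> \<in> space (prb S) \<Longrightarrow>
      \<bar>gen S n \<omega> x1 y1 z1 u1 - gen S n \<omega> x2 y2 z2 u2\<bar>
        \<le> L * (\<bar>x1 - x2\<bar> + \<bar>y1 - y2\<bar> + \<bar>z1 - z2\<bar> + \<bar>u1 - u2\<bar>)"
    by (rule coefficients_Lipschitz) (rule that)
  have "\<bar>drift_x S us Xs n \<omega>\<bar> \<le> L" "\<bar>vol_x S us Xs n \<omega>\<bar> \<le> L" "\<bar>gen_x S us Xs Ys Zs n \<omega>\<bar> \<le> L"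
    "\<bar>gen_y S us Xs Ys Zs n \<omega>\<bar> \<le> L" "\<bar>gen_z S us Xs Ys Zs n \<omega>\<bar> \<le> L"
    if \<omega>: "\<omega> \<in> space (prb S)" for n \<omega>
  proof -
    note d = partials_differentiable[OF \<omega>, of n]
    show "\<bar>drift_x S us Xs n \<omega>\<bar> \<le> L" unfolding drift_x_def
      by (rule abs_deriv_le_Lipschitz[OF d(1)]) (use L(2)[OF \<omega>, of n _ "us n \<omega>" _ "us n \<omega>"] in simp)
    show "\<bar>vol_x S us Xs n \<omega>\<bar> \<le> L" unfolding vol_x_def
      by (rule abs_deriv_le_Lipschitz[OF d(2)]) (use L(3)[OF \<omega>, of n _ "us n \<omega>" _ "us n \<omega>"] in simp)
    show "\<bar>gen_x S us Xs Ys Zs n \<omega>\<bar> \<le> L" unfolding gen_x_def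
      by (rule abs_deriv_le_Lipschitz[OF d(3)])
        (use L(4)[OF \<omega>, of n _ "Ys n \<omega>" "Zs n \<omega>" "us n \<omega>" _ "Ys n \<omega>" "Zs n \<omega>" "us n \<omega>"] in simp)
    show "\<bar>gen_y S us Xs Ys Zs n \<omega>\<bar> \<le> L" unfolding gen_y_def
      by (rule abs_deriv_le_Lipschitz[OF d(4)])
        (use L(4)[OF \<omega>, of n "Xs n \<omega>" _ "Zs n \<omega>" "us n \<omega>" "Xs n \<omega>" _ "Zs n \<omega>" "us n \<omega>"] in simp)
    show "\<bar>gen_z S us Xs Ys Zs n \<omega>\<bar> \<le> L" unfolding gen_z_def
      by (rule abs_deriv_le_Lipschitz[OF d(5)])
        (use L(4)[OF \<omega>, of n "Xs n \<omega>" "Ys n \<omega>" _ "us n \<omega>" "Xs n \<omega>" "Ys n \<omega>" _ "us n \<omega>"] in simp)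
  qed
  then show ?thesis by blast
qed

text \<open>The hypotheses determine \<^term>\<open>k\<close> only almost surely, so it need not be adapted;
  this is its adapted version.\<close>

primrec kad :: "'a process" where
  "kad 0 = (\<lambda>\<omega>. 0)"
| "kad (Suc n) = (if n = 0 then (\<lambda>\<omega>. - 1) else (\<lambda>\<omega>.
     (1 + gen_y S us Xs Ys Zs n \<omega>) * kad n \<omega> + gen_z S us Xs Ys Zs n \<omega> * kad n \<omega> * eta S n \<omega>))"

lemma k_eq_kad: "AE \<omega> in prb S. k n \<omega> = kad n \<omega>"
proof (induction n)
  case 0
  then show ?case using adj_k by (simp add: adjoint_forward_def)
next
  case (Suc n)
  show ?case
  proof (cases "n = 0")
    case True
    then show ?thesis using adj_k by (simp add: adjoint_forward_def)
  next
    case False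
    then have "AE \<omega> in prb S. k (Suc n) \<omega> =
        k n \<omega> + gen_y S us Xs Ys Zs n \<omega> * k n \<omega> + gen_z S us Xs Ys Zs n \<omega> * k n \<omega> * eta S n \<omega>"
      using adj_k by (simp add: adjoint_forward_def)
    then show ?thesis
      using Suc by eventually_elim (simp add: False algebra_simps)
  qed
qed

lemma kad_square_negligible: "kad \<in> square_negligible"
proof -
  obtain L where L: "\<And>n \<omega>. \<omega> \<in> space (prb S) \<Longrightarrow> \<bar>gen_y S us Xs Ys Zs n \<omega>\<bar> \<le> L"
    "\<And>n \<omega>. \<omega> \<in> space (prb S) \<Longrightarrow> \<bar>gen_z S us Xs Ys Zs n \<omega>\<bar> \<le> L"
    using partials_bounded by blast
  show ?thesis
  proof (rule linear_recursion_square_negligible[where a = "\<lambda>n \<omega>. 1 + gen_y S us Xs Ys Zs n \<omega>"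
        and b = "gen_z S us Xs Ys Zs" and L = "1 + L"])
    show "\<bar>1 + gen_y S us Xs Ys Zs n \<omega>\<bar> \<le> 1 + L" "\<bar>gen_z S us Xs Ys Zs n \<omega>\<bar> \<le> 1 + L"
      if "\<omega> \<in> space (prb S)" for n \<omega>
      using L[OF that, of n] by linarith+
    show "(\<lambda>\<omega>. 1 + gen_y S us Xs Ys Zs n \<omega>) \<in> borel_measurable (filt S n)" for n
      using partials_adapted(4) by simp
  qed (simp_all add: partials_adapted)
qed

text \<open>The comparison is with an arbitrary solution for \<open>u\<close>, so the infimum over
  solutions in \<open>J\<close> can be bounded below without a uniqueness result.\<close>

lemma cost_le:
  assumes u: "u \<in> fwd_space S" and sol: "system_solution S u X Y Z"
    and conv: "\<And>n. AE \<omega> in prb S. convex_on UNIV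
           (\<lambda>(x, y, z, u). hamiltonian S n \<omega> x y z u (p n \<omega>) (q n \<omega>) (k n \<omega>))"
    and max: "\<And>n. AE \<omega> in prb S.
           (drift_u S us Xs n \<omega> * p n \<omega>
            + vol_u S us Xs n \<omega> * p n \<omega> * (\<Sum>j<n. gammac S n j * xi S j \<omega>)
            + beta S n n * vol_u S us Xs n \<omega> * q n \<omega>
            - gen_u S us Xs Ys Zs n \<omega> * k n \<omega>) * (u n \<omega> - us n \<omega>) \<ge> 0"
  shows "(\<integral>\<omega>. Ys 0 \<omega> \<partial>prb S) \<le> (\<integral>\<omega>. Y 0 \<omega> \<partial>prb S)"
proof -
  have spaces': "X \<in> fwd_space S" "Y \<in> bwd_space S" "Z \<in> bwd_space S"
    using sol by (auto simp: system_solution_def state_solution_def backward_solution_def)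
  note ad = adapted' space_adapted(1)[OF u] space_adapted(1)[OF spaces'(1)]
    space_adapted(2)[OF spaces'(2)] space_adapted(2)[OF spaces'(3)]
  define dX dY dZ du where "dX n \<omega> = X n \<omega> - Xs n \<omega>" and "dY n \<omega> = Y n \<omega> - Ys n \<omega>"
    and "dZ n \<omega> = Z n \<omega> - Zs n \<omega>" and "du n \<omega> = u n \<omega> - us n \<omega>" for n \<omega>
  define db ds df where "db n \<omega> = drift S n \<omega> (X n \<omega>) (u n \<omega>) - drift S n \<omega> (Xs n \<omega>) (us n \<omega>)"
    and "ds n \<omega> = vol S n \<omega> (X n \<omega>) (u n \<omega>) - vol S n \<omega> (Xs n \<omega>) (us n \<omega>)"
    and "df n \<omega> = gen S n \<omega> (X n \<omega>) (Y n \<omega>) (Z n \<omega>) (u n \<omega>) - gen S n \<omega> (Xs n \<omega>) (Ys n \<omega>) (Zs n \<omega>) (us n \<omega>)"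
    for n \<omega>
  define bx sx fx fy fz where "bx = drift_x S us Xs" and "sx = vol_x S us Xs" and "fx = gen_x S us Xs Ys Zs"
    and "fy = gen_y S us Xs Ys Zs" and "fz = gen_z S us Xs Ys Zs"
  note partial_defs = bx_def sx_def fx_def fy_def fz_def
  \<comment> \<open>This is the driver of the equation for \<open>p\<close> with \<open>k\<close>
    and \<open>cond_xi\<close> replaced by their adapted versions; the two agree almost
    surely.\<close>
  define G where "G n \<omega> = bx n \<omega> * p n \<omega> + beta S n n * sx n \<omega> * q n \<omega> - fx n \<omega> * kad n \<omega>
    + sx n \<omega> * p n \<omega> * xi_pred n \<omega>" for n \<omega>
  obtain L where L: "0 < L"
    "\<And>n \<omega> x1 x2 u1 u2. \<omega> \<in> space (prb S) \<Longrightarrow>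
      \<bar>drift S n \<omega> x1 u1 - drift S n \<omega> x2 u2\<bar> \<le> L * (\<bar>x1 - x2\<bar> + \<bar>u1 - u2\<bar>)"
    "\<And>n \<omega> x1 x2 u1 u2. \<omega> \<in> space (prb S) \<Longrightarrow>
      \<bar>vol S n \<omega> x1 u1 - vol S n \<omega> x2 u2\<bar> \<le> L * (\<bar>x1 - x2\<bar> + \<bar>u1 - u2\<bar>)"
    "\<And>n \<omega> x1 x2 y1 y2 z1 z2 u1 u2. \<omega> \<in> space (prb S) \<Longrightarrow>
      \<bar>gen S n \<omega> x1 y1 z1 u1 - gen S n \<omega> x2 y2 z2 u2\<bar>
        \<le> L * (\<bar>x1 - x2\<bar> + \<bar>y1 - y2\<bar> + \<bar>z1 - z2\<bar> + \<bar>u1 - u2\<bar>)"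
    by (rule coefficients_Lipschitz) (rule that)
  obtain B where B: "\<And>n \<omega>. \<omega> \<in> space (prb S) \<Longrightarrow> \<bar>bx n \<omega>\<bar> \<le> B"
    "\<And>n \<omega>. \<omega> \<in> space (prb S) \<Longrightarrow> \<bar>sx n \<omega>\<bar> \<le> B"
    "\<And>n \<omega>. \<omega> \<in> space (prb S) \<Longrightarrow> \<bar>fx n \<omega>\<bar> \<le> B"
    "\<And>n \<omega>. \<omega> \<in> space (prb S) \<Longrightarrow> \<bar>fy n \<omega>\<bar> \<le> B"
    "\<And>n \<omega>. \<omega> \<in> space (prb S) \<Longrightarrow> \<bar>fz n \<omega>\<bar> \<le> B"
    using partials_bounded unfolding partial_defs by blast
  have pad: "bx n \<in> borel_measurable (filt S n)" "sx n \<in> borel_measurable (filt S n)"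
    "fx n \<in> borel_measurable (filt S n)" "fy n \<in> borel_measurable (filt S n)"
    "fz n \<in> borel_measurable (filt S n)" for n
    unfolding partial_defs by (rule partials_adapted)+
  obtain K where K: "\<And>n k. \<bar>beta S n k\<bar> \<le> K" using beta_bounded by blast

  have sn_dX: "dX \<in> square_negligible" "(\<lambda>n \<omega>. dX n \<omega> * xi_pred n \<omega>) \<in> square_negligible"
    unfolding dX_def[abs_def] by (rule fwd_space_diff_negligible[OF spaces'(1) spaces(1)])+
  have sn_du: "du \<in> square_negligible" "(\<lambda>n \<omega>. du n \<omega> * xi_pred n \<omega>) \<in> square_negligible"
    unfolding du_def[abs_def] by (rule fwd_space_diff_negligible[OF u us])+
  have sn_dY: "dY \<in> square_negligible" and sn_dZ: "dZ \<in> square_negligible"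
    unfolding dY_def[abs_def] dZ_def[abs_def]
    by (intro square_negligible_diff bwd_space_negligible spaces spaces')+
  have sn_p: "p \<in> square_negligible" and sn_q: "q \<in> square_negligible"
    by (intro bwd_space_negligible spaces)+
  note sn_k = kad_square_negligible
  have db_ad: "db n \<in> borel_measurable (filt S n)" and ds_ad: "ds n \<in> borel_measurable (filt S n)"
    and df_ad: "df n \<in> borel_measurable (filt S n)" for n
    unfolding db_def[abs_def] ds_def[abs_def] df_def[abs_def]
    by (intro borel_measurable_diff drift_adapted vol_adapted gen_adapted ad)+
  have sn_db: "db \<in> square_negligible"
    by (rule square_negligible_dominated[OF db_ad sn_dX(1) sn_du(1)])
      (unfold db_def dX_def du_def, rule L(2))
  have sn_ds: "ds \<in> square_negligible"
    by (rule square_negligible_dominated[OF ds_ad sn_dX(1) sn_du(1)])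
      (unfold ds_def dX_def du_def, rule L(3))
  \<comment> \<open>The increment of the volatility is bounded by \<open>dX\<close> and
    \<open>du\<close>, both from the forward space, so it tolerates the factor
    \<open>xi_pred\<close>.\<close>
  have sn_dsc: "(\<lambda>n \<omega>. ds n \<omega> * xi_pred n \<omega>) \<in> square_negligible"
  proof (rule square_negligible_dominated[OF _ sn_dX(2) sn_du(2)])
    show "(\<lambda>\<omega>. ds n \<omega> * xi_pred n \<omega>) \<in> borel_measurable (filt S n)" for n
      by (intro borel_measurable_times ds_ad xi_pred_adapted)
    fix n \<omega> assume \<omega>: "\<omega> \<in> space (prb S)"
    have "\<bar>ds n \<omega>\<bar> * \<bar>xi_pred n \<omega>\<bar> \<le> L * (\<bar>dX n \<omega>\<bar> + \<bar>du n \<omega>\<bar>) * \<bar>xi_pred n \<omega>\<bar>"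
      unfolding ds_def dX_def du_def by (intro mult_right_mono L(3)[OF \<omega>]) simp
    then show "\<bar>ds n \<omega> * xi_pred n \<omega>\<bar> \<le> L * (\<bar>dX n \<omega> * xi_pred n \<omega>\<bar> + \<bar>du n \<omega> * xi_pred n \<omega>\<bar>)"
      by (simp add: abs_mult algebra_simps)
  qed
  \<comment> \<open>The Lipschitz bound has four terms; they are grouped in pairs, with absolute
    values, to fit the two-term domination lemma.\<close>
  have sn_df: "df \<in> square_negligible"
  proof (rule square_negligible_dominated[OF df_ad
        square_negligible_add[OF square_negligible_abs[OF sn_dX(1)] square_negligible_abs[OF sn_dY]]
        square_negligible_add[OF square_negligible_abs[OF sn_dZ] square_negligible_abs[OF sn_du(1)]]])
    fix n \<omega> assume "\<omega> \<in> space (prb S)"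
    from L(4)[OF this, of n "X n \<omega>" "Y n \<omega>" "Z n \<omega>" "u n \<omega>" "Xs n \<omega>" "Ys n \<omega>" "Zs n \<omega>" "us n \<omega>"]
    show "\<bar>df n \<omega>\<bar> \<le> L * (\<bar>\<bar>dX n \<omega>\<bar> + \<bar>dY n \<omega>\<bar>\<bar> + \<bar>\<bar>dZ n \<omega>\<bar> + \<bar>du n \<omega>\<bar>\<bar>)"
      by (simp add: df_def dX_def dY_def dZ_def du_def add.assoc)
  qed
  have sn_bds: "(\<lambda>n \<omega>. beta S n n * ds n \<omega>) \<in> square_negligible"
    by (rule square_negligible_mult_bounded[OF sn_ds borel_measurable_const K])
  have sn_yk: "(\<lambda>n \<omega>. (1 + fy n \<omega>) * kad n \<omega>) \<in> square_negligible"
  proof (rule square_negligible_mult_bounded[OF sn_k, of _ "1 + B"])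
    show "(\<lambda>\<omega>. 1 + fy n \<omega>) \<in> borel_measurable (filt S n)" for n using pad(4) by simp
    show "\<bar>1 + fy n \<omega>\<bar> \<le> 1 + B" if "\<omega> \<in> space (prb S)" for n \<omega> using B(4)[OF that, of n] by linarith
  qed
  have sn_zk: "(\<lambda>n \<omega>. fz n \<omega> * kad n \<omega>) \<in> square_negligible"
    by (rule square_negligible_mult_bounded[OF sn_k pad(5) B(5)])
  have sn_C: "(\<lambda>n \<omega>. dX n \<omega> + db n \<omega> + ds n \<omega> * xi_pred n \<omega>) \<in> square_negligible"
    by (intro square_negligible_add sn_dX sn_db sn_dsc)
  have sn_R: "(\<lambda>n \<omega>. dY n \<omega> + df n \<omega>) \<in> square_negligible"
    by (intro square_negligible_add sn_dY sn_df)
  note bd = square_negligible_mult_bounded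
  have sn_bX: "(\<lambda>n \<omega>. bx n \<omega> * dX n \<omega>) \<in> square_negligible"
    by (rule bd[OF sn_dX(1) pad(1) B(1)])
  have sn_sX: "(\<lambda>n \<omega>. beta S n n * (sx n \<omega> * dX n \<omega>)) \<in> square_negligible"
    by (rule bd[OF bd[OF sn_dX(1) pad(2) B(2)] borel_measurable_const K])
  have sn_fX: "(\<lambda>n \<omega>. fx n \<omega> * dX n \<omega>) \<in> square_negligible"
    by (rule bd[OF sn_dX(1) pad(3) B(3)])
  have sn_sXc: "(\<lambda>n \<omega>. sx n \<omega> * (dX n \<omega> * xi_pred n \<omega>)) \<in> square_negligible"
    by (rule bd[OF sn_dX(2) pad(2) B(2)])

  have n_T: "(\<lambda>n \<omega>. kad n \<omega> * (dY n \<omega> + df n \<omega>)) \<in> negligible"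
    by (rule square_negligible_mult[OF sn_k sn_R])
  \<comment> \<open>\<open>G\<close> contains \<open>p\<close> times \<open>xi_pred\<close>, which
    is not known to be square-negligible. Regrouping moves \<open>xi_pred\<close> and the partial
    derivatives onto \<open>dX\<close>, so that every product has two factors of the class.\<close>
  have n_S: "(\<lambda>n \<omega>. dX n \<omega> * (p n \<omega> + G n \<omega>)) \<in> negligible"
  proof -
    have "(\<lambda>n \<omega>. dX n \<omega> * p n \<omega> + bx n \<omega> * dX n \<omega> * p n \<omega> + beta S n n * (sx n \<omega> * dX n \<omega>) * q n \<omega>
        - fx n \<omega> * dX n \<omega> * kad n \<omega> + sx n \<omega> * (dX n \<omega> * xi_pred n \<omega>) * p n \<omega>) \<in> negligible"
      by (intro negligible_add negligible_diff square_negligible_mult sn_dX sn_p sn_q sn_k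
          sn_bX sn_sX sn_fX sn_sXc)
    then show ?thesis by (simp add: G_def algebra_simps)
  qed
  define T where "T n = wt S n * (\<integral>\<omega>. kad n \<omega> * (dY n \<omega> + df n \<omega>) \<partial>prb S)" for n
  define R where "R n = wt S n * (\<integral>\<omega>. dX n \<omega> * (p n \<omega> + G n \<omega>) \<partial>prb S)" for n
  have lim: "(\<lambda>n. T n + R n) \<longlonglongrightarrow> 0"
    unfolding T_def R_def using tendsto_add[OF negligibleD(2)[OF n_T] negligibleD(2)[OF n_S]] by simp

  have bwdY: "AE \<omega> in prb S. wt S n * (dY n \<omega> + dZ n \<omega> * eta S n \<omega>)
      = wt S (Suc n) * (dY (Suc n) \<omega> + df (Suc n) \<omega>)" for n
  proof -
    have "AE \<omega> in prb S. wt S n * (Y n \<omega> + Z n \<omega> * eta S n \<omega>) = wt S (Suc n) * (Y (Suc n) \<omega> +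
        gen S (Suc n) \<omega> (X (Suc n) \<omega>) (Y (Suc n) \<omega>) (Z (Suc n) \<omega>) (u (Suc n) \<omega>))"
      and "AE \<omega> in prb S. wt S n * (Ys n \<omega> + Zs n \<omega> * eta S n \<omega>) = wt S (Suc n) * (Ys (Suc n) \<omega> +
        gen S (Suc n) \<omega> (Xs (Suc n) \<omega>) (Ys (Suc n) \<omega>) (Zs (Suc n) \<omega>) (us (Suc n) \<omega>))"
      using sys sol by (auto simp: system_solution_def backward_solution_def)
    then show ?thesis
      by eventually_elim (simp add: dY_def dZ_def df_def algebra_simps)
  qed
  have bwdp: "AE \<omega> in prb S. wt S n * (p n \<omega> + q n \<omega> * eta S n \<omega>)
      = wt S (Suc n) * (p (Suc n) \<omega> + G (Suc n) \<omega>)" for n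
  proof -
    have "AE \<omega> in prb S. wt S n * (p n \<omega> + q n \<omega> * eta S n \<omega>) =
        wt S (Suc n) * (p (Suc n) \<omega>
          + drift_x S us Xs (Suc n) \<omega> * p (Suc n) \<omega>
          + beta S (Suc n) (Suc n) * vol_x S us Xs (Suc n) \<omega> * q (Suc n) \<omega>
          - gen_x S us Xs Ys Zs (Suc n) \<omega> * k (Suc n) \<omega>
          + vol_x S us Xs (Suc n) \<omega> * p (Suc n) \<omega> * cond_xi S (Suc n) \<omega>)"
      using adj_p by (simp add: adjoint_backward_def)
    with k_eq_kad[of "Suc n"] cond_xi_eq[of "Suc n"] show ?thesis
      by eventually_elim (simp add: G_def partial_defs del: kad.simps)
  qed
  \<comment> \<open>Substituting the split of \<open>xi\<close> separates an adapted coefficient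
    from the coefficient of the innovation, as the duality step requires.\<close>
  have fwdX: "AE \<omega> in prb S. dX (Suc n) \<omega>
      = (dX n \<omega> + db n \<omega> + ds n \<omega> * xi_pred n \<omega>) + beta S n n * ds n \<omega> * eta S n \<omega>" for n
  proof -
    have "AE \<omega> in prb S. X (Suc n) \<omega> =
        X n \<omega> + drift S n \<omega> (X n \<omega>) (u n \<omega>) + vol S n \<omega> (X n \<omega>) (u n \<omega>) * xi S n \<omega>"
      and "AE \<omega> in prb S. Xs (Suc n) \<omega> =
        Xs n \<omega> + drift S n \<omega> (Xs n \<omega>) (us n \<omega>) + vol S n \<omega> (Xs n \<omega>) (us n \<omega>) * xi S n \<omega>"
      using sys sol by (auto simp: system_solution_def state_solution_def)
    with AE_space[of "prb S"] show ?thesis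
      by eventually_elim (simp add: dX_def db_def ds_def xi_decomp algebra_simps)
  qed
  have dX0: "AE \<omega> in prb S. dX 0 \<omega> = 0"
  proof -
    have "AE \<omega> in prb S. X 0 \<omega> = init S \<omega>" "AE \<omega> in prb S. Xs 0 \<omega> = init S \<omega>"
      using sys sol by (auto simp: system_solution_def state_solution_def)
    then show ?thesis by eventually_elim (simp add: dX_def)
  qed

  note m = square_negligibleD(1)
  note i = negligibleD(1)[OF square_negligible_mult]
  have R_Suc: "R (Suc n) = wt S n * (\<integral>\<omega>. p n \<omega> * (dX n \<omega> + db n \<omega> + ds n \<omega> * xi_pred n \<omega>)
      + q n \<omega> * (beta S n n * ds n \<omega>) \<partial>prb S)" for n
    unfolding R_def
    by (rule duality_step[OF m[OF sn_p] m[OF sn_q] m[OF sn_C] m[OF sn_bds] i[OF sn_p sn_C] i[OF sn_p sn_bds]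
          i[OF sn_q sn_C] i[OF sn_q sn_bds] bwdp fwdX borel_measurable_integrable[OF negligibleD(1)[OF n_S]]])
  have T_Suc: "T (Suc n) = wt S n * (\<integral>\<omega>. dY n \<omega> * ((1 + fy n \<omega>) * kad n \<omega>) + dZ n \<omega> * (fz n \<omega> * kad n \<omega>) \<partial>prb S)"
    if "1 \<le> n" for n
    unfolding T_def
  proof (rule duality_step[OF m[OF sn_dY] m[OF sn_dZ] m[OF sn_yk] m[OF sn_zk] i[OF sn_dY sn_yk] i[OF sn_dY sn_zk]
          i[OF sn_dZ sn_yk] i[OF sn_dZ sn_zk] bwdY _ borel_measurable_integrable[OF negligibleD(1)[OF n_T]]])
    show "AE \<omega> in prb S. kad (Suc n) \<omega> = (1 + fy n \<omega>) * kad n \<omega> + fz n \<omega> * kad n \<omega> * eta S n \<omega>"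
      using that by (simp add: partial_defs)
  qed
  have int_Y0: "integrable (prb S) (V 0)" if "V \<in> square_negligible" for V
    using square_negligibleD(2,3)[OF that] square_integrable_imp_integrable by blast
  \<comment> \<open>The constant -1 at time 1 is treated as a forward step with C = -1 and D = 0.
    The weight at time 0 equals 1.\<close>
  have T1: "T 1 = - (\<integral>\<omega>. dY 0 \<omega> \<partial>prb S)"
  proof -
    have "T (Suc 0) = wt S 0 * (\<integral>\<omega>. dY 0 \<omega> * (- 1) + dZ 0 \<omega> * 0 \<partial>prb S)"
      unfolding T_def
      by (rule duality_step[OF m[OF sn_dY] m[OF sn_dZ] _ _ _ _ _ _ bwdY _ borel_measurable_integrable[OF negligibleD(1)[OF n_T]]])
        (use int_Y0[OF sn_dY] int_Y0[OF sn_dZ] in auto)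
    then show ?thesis by (simp add: wt_def)
  qed

  \<comment> \<open>All terms live at time n: the two pairings that compute the values at
    \<open>Suc n\<close>, minus those at n. The terms k dY and p dX cancel, leaving the Hamiltonian
    increment minus its linear part in x, y, z.\<close>
  define D where "D n \<omega> = dY n \<omega> * ((1 + fy n \<omega>) * kad n \<omega>) + dZ n \<omega> * (fz n \<omega> * kad n \<omega>)
      - kad n \<omega> * (dY n \<omega> + df n \<omega>)
      + (p n \<omega> * (dX n \<omega> + db n \<omega> + ds n \<omega> * xi_pred n \<omega>) + q n \<omega> * (beta S n n * ds n \<omega>))
      - dX n \<omega> * (p n \<omega> + G n \<omega>)" for n \<omega>
  have D_nonneg: "AE \<omega> in prb S. 0 \<le> D n \<omega>" for n
    using conv[of n] max[of n] k_eq_kad[of n] cond_xi_eq[of n] AE_space[of "prb S"]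
  proof eventually_elim
    case (elim \<omega>)
    note h = hamiltonian_above_tangent_plane[OF elim(5,1), of "Xs n \<omega>" "Ys n \<omega>" "Zs n \<omega>" "us n \<omega>"
        "X n \<omega>" "Y n \<omega>" "Z n \<omega>" "u n \<omega>",
        folded drift_x_def vol_x_def gen_x_def gen_y_def gen_z_def drift_u_def vol_u_def gen_u_def]
    \<comment> \<open>The \<open>gammac\<close> sum is replaced by \<open>cond_xi\<close>, so the
      inequality becomes exactly nonnegativity of the control part of the tangent plane, which can
      then be dropped.\<close>
    have "(drift_u S us Xs n \<omega> * p n \<omega> + vol_u S us Xs n \<omega> * p n \<omega> * cond_xi S n \<omega>
            + beta S n n * vol_u S us Xs n \<omega> * q n \<omega>
            - gen_u S us Xs Ys Zs n \<omega> * k n \<omega>) * (u n \<omega> - us n \<omega>) \<ge> 0"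
      using elim(2) unfolding xi_pred_gammac[OF elim(5)] elim(4) .
    with h have "hamiltonian S n \<omega> (Xs n \<omega>) (Ys n \<omega>) (Zs n \<omega>) (us n \<omega>) (p n \<omega>) (q n \<omega>) (k n \<omega>)
        + (bx n \<omega> * p n \<omega> + sx n \<omega> * p n \<omega> * cond_xi S n \<omega>
          + beta S n n * sx n \<omega> * q n \<omega> - fx n \<omega> * k n \<omega>) * dX n \<omega>
        - fy n \<omega> * k n \<omega> * dY n \<omega> - fz n \<omega> * k n \<omega> * dZ n \<omega>
      \<le> hamiltonian S n \<omega> (X n \<omega>) (Y n \<omega>) (Z n \<omega>) (u n \<omega>) (p n \<omega>) (q n \<omega>) (k n \<omega>)"
      unfolding partial_defs dX_def dY_def dZ_def by linarith
    then show ?case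
      unfolding hamiltonian_def elim(3,4) D_def G_def db_def ds_def df_def
      by (simp add: algebra_simps)
  qed

  have mono: "T n + R n \<le> T (Suc n) + R (Suc n)" if n: "1 \<le> n" for n
  proof -
    note j = i[OF sn_dY sn_yk, of n] i[OF sn_dZ sn_zk, of n] negligibleD(1)[OF n_T, of n]
      i[OF sn_p sn_C, of n] i[OF sn_q sn_bds, of n] negligibleD(1)[OF n_S, of n]
    have "(\<integral>\<omega>. D n \<omega> \<partial>prb S)
        = (\<integral>\<omega>. dY n \<omega> * ((1 + fy n \<omega>) * kad n \<omega>) + dZ n \<omega> * (fz n \<omega> * kad n \<omega>) \<partial>prb S)
          - (\<integral>\<omega>. kad n \<omega> * (dY n \<omega> + df n \<omega>) \<partial>prb S)
          + (\<integral>\<omega>. p n \<omega> * (dX n \<omega> + db n \<omega> + ds n \<omega> * xi_pred n \<omega>) + q n \<omega> * (beta S n n * ds n \<omega>) \<partial>prb S)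
          - (\<integral>\<omega>. dX n \<omega> * (p n \<omega> + G n \<omega>) \<partial>prb S)"
      unfolding D_def
      by (simp only: Bochner_Integration.integral_add Bochner_Integration.integral_diff
          Bochner_Integration.integrable_add Bochner_Integration.integrable_diff j)
    moreover have "c * r1 + c * r2 - (c * r3 + c * r4) = c * (r1 - r3 + r2 - r4)" for c r1 r2 r3 r4 :: real
      by (simp add: algebra_simps)
    ultimately have "T (Suc n) + R (Suc n) - (T n + R n) = wt S n * (\<integral>\<omega>. D n \<omega> \<partial>prb S)"
      unfolding T_Suc[OF n] R_Suc unfolding T_def R_def by presburger
    moreover have "0 \<le> (\<integral>\<omega>. D n \<omega> \<partial>prb S)" by (rule integral_nonneg_AE[OF D_nonneg])
    ultimately show ?thesis
      using mult_nonneg_nonneg[OF less_imp_le[OF w_pos[of n]], of "\<integral>\<omega>. D n \<omega> \<partial>prb S"] by linarith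
  qed
  have "incseq (\<lambda>n. T (Suc n) + R (Suc n))"
    by (rule incseq_SucI) (rule mono, simp)
  \<comment> \<open>An increasing sequence stays below its limit, here 0. No infinite series of
    Hamiltonian increments has to be summed.\<close>
  then have le0: "T (Suc 0) + R (Suc 0) \<le> 0"
    using incseq_le[of "\<lambda>n. T (Suc n) + R (Suc n)"] LIMSEQ_Suc[OF lim] by simp
  have "0 \<le> R (Suc 0)"
  proof -
    \<comment> \<open>At time 0 both \<open>kad\<close> and \<open>dX\<close> vanish, so
      \<open>D 0\<close> reduces to the integrand that computes \<open>R\<close> at time 1.\<close>
    have "AE \<omega> in prb S. 0 \<le> p 0 \<omega> * (dX 0 \<omega> + db 0 \<omega> + ds 0 \<omega> * xi_pred 0 \<omega>) + q 0 \<omega> * (beta S 0 0 * ds 0 \<omega>)"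
      using D_nonneg[of 0] dX0 by eventually_elim (simp add: D_def)
    then show ?thesis
      unfolding R_Suc using w_pos[of 0] by (intro mult_nonneg_nonneg integral_nonneg_AE) auto
  qed
  then have "0 \<le> (\<integral>\<omega>. dY 0 \<omega> \<partial>prb S)"
    using le0 T1 by simp
  also have "(\<integral>\<omega>. dY 0 \<omega> \<partial>prb S) = (\<integral>\<omega>. Y 0 \<omega> \<partial>prb S) - (\<integral>\<omega>. Ys 0 \<omega> \<partial>prb S)"
    unfolding dY_def using int_Y0[OF bwd_space_negligible[OF spaces'(2)]] int_Y0[OF bwd_space_negligible[OF spaces(2)]]
    by simp
  finally show ?thesis by simp
qed

end

theorem theorem7:
  fixes S :: "'a control_problem"
    and us Xs Ys Zs p q k :: "'a process"
  assumes "noise_setup S" and "coefficient_setup S"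
    and "A1 S" and "A2 S" and "A3 S"
    and "us \<in> controls S"
    and "system_solution S us Xs Ys Zs"
    and "adjoint_forward S us Xs Ys Zs k"
    and "adjoint_backward S us Xs Ys Zs k p q"
    and "\<And>n. AE \<omega> in prb S. convex_on UNIV
           (\<lambda>(x, y, z, u). hamiltonian S n \<omega> x y z u (p n \<omega>) (q n \<omega>) (k n \<omega>))"
    and "\<And>u n. u \<in> controls S \<Longrightarrow> AE \<omega> in prb S.
           (drift_u S us Xs n \<omega> * p n \<omega>
            + vol_u S us Xs n \<omega> * p n \<omega> * (\<Sum>j<n. gammac S n j * xi S j \<omega>)
            + beta S n n * vol_u S us Xs n \<omega> * q n \<omega>
            - gen_u S us Xs Ys Zs n \<omega> * k n \<omega>) * (u n \<omega> - us n \<omega>) \<ge> 0"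
  shows "J S us = ereal (\<integral>\<omega>. Ys 0 \<omega> \<partial>prb S) \<and> J S us = (INF u\<in>controls S. J S u)"
proof -
  interpret adjoint_system S us Xs Ys Zs k p q
    by unfold_locales (use assms in \<open>simp_all add: controls_def\<close>)
  \<comment> \<open>\<open>J S u\<close> is an infimum over solutions, infinite if there are none,
    so a lower bound for each single solution is enough.\<close>
  have le: "ereal (\<integral>\<omega>. Ys 0 \<omega> \<partial>prb S) \<le> J S u" if u: "u \<in> controls S" for u
    unfolding J_def
  proof (rule INF_greatest, clarify)
    fix X Y Z assume "system_solution S u X Y Z"
    moreover have "u \<in> fwd_space S" using u by (simp add: controls_def)
    ultimately show "ereal (\<integral>\<omega>. Ys 0 \<omega> \<partial>prb S) \<le> ereal (\<integral>\<omega>. Y 0 \<omega> \<partial>prb S)"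
      using cost_le[OF _ _ assms(10) assms(11)[OF u]] by simp
  qed
  have "J S us \<le> ereal (\<integral>\<omega>. Ys 0 \<omega> \<partial>prb S)"
    unfolding J_def by (rule INF_lower2[of "(Xs, Ys, Zs)"]) (use assms(7) in auto)
  then have eq: "J S us = ereal (\<integral>\<omega>. Ys 0 \<omega> \<partial>prb S)"
    using le[OF assms(6)] by (rule antisym)
  moreover have "J S us = (INF u\<in>controls S. J S u)"
    using le assms(6) eq by (intro antisym INF_greatest INF_lower) auto
  ultimately show ?thesis by blast
qed

end
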